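(* The space $\mathcal U_{\star\mathbb R}^{\mathcal L}$ of $\Lambda$-local $\star$-real unitaries (defined in the context) has exactly one path component: $$\pi_0(\mathcal U_{\star\mathbb R}^{\mathcal L})\cong\{0\}.$$
   Context: $\mathcal H$ is an infinite-dimensional separable complex Hilbert space, $\mathcal B$ its bounded linear operators with the operator norm topology, $\mathcal K$ the compact operators. $\Lambda\in\mathcal B$ is a fixed self-adjoint projection whose range and kernel are both infinite-dimensional. $A\in\mathcal B$ is called $\Lambda$-local iff $\Lambda A-A\Lambda\in\mathcal K$; $\mathcal L$ is the set of all $\Lambda$-local operators. $C:\mathcal H\to\mathcal H$ is a fixed anti-unitary operator with $C^2=\mathbb 1$ and $C\Lambda=\Lambda C$. $\mathcal U_{\star\mathbb R}^{\mathcal L}$ is the set of unitaries $U\in\mathcal L$ with $UC=CU^*$, with the subspace topology from the operator norm. $\pi_0$ denotes the set of path components. *)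

theory Defs
  imports "HOL-Analysis.Analysis"
begin

text \<open>
  The library has only real inner product spaces. A complex Hilbert space is a real Hilbert space
  with a compatible complex scalar multiplication and a sesquilinear form (conjugate-linear in the
  first argument) whose real part is the real inner product; in particular
  \<open>norm x = sqrt (Re (cinner x x))\<close>, and \<open>cinner\<close> is positive definite because
  \<open>inner\<close> is.
\<close>

class complex_hilbert_space = real_inner + banach +
  fixes scaleC :: "complex \<Rightarrow> 'a \<Rightarrow> 'a" (infixr "*\<^sub>C" 75)
    and cinner :: "'a \<Rightarrow> 'a \<Rightarrow> complex"
  assumes scaleC_add_right: "c *\<^sub>C (x + y) = c *\<^sub>C x + c *\<^sub>C y"
    and scaleC_add_left: "(c + d) *\<^sub>C x = c *\<^sub>C x + d *\<^sub>C x"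
    and scaleC_scaleC: "c *\<^sub>C d *\<^sub>C x = (c * d) *\<^sub>C x"
    and scaleC_one: "1 *\<^sub>C x = x"
    and scaleR_eq_scaleC: "r *\<^sub>R x = complex_of_real r *\<^sub>C x"
    and cinner_commute: "cinner x y = cnj (cinner y x)"
    and cinner_add_right: "cinner x (y + z) = cinner x y + cinner x z"
    and cinner_scaleC_right: "cinner x (c *\<^sub>C y) = c * cinner x y"
    and inner_eq_Re_cinner: "inner x y = Re (cinner x y)"

global_interpretation complex_vector:
  vector_space "scaleC :: complex \<Rightarrow> 'a \<Rightarrow> 'a::complex_hilbert_space"
  by unfold_locales (simp_all add: scaleC_add_right scaleC_add_left scaleC_scaleC scaleC_one)

definition infinite_cdim :: "'a::complex_hilbert_space set \<Rightarrow> bool" where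
  "infinite_cdim S \<longleftrightarrow> (\<nexists>B. finite B \<and> S \<subseteq> complex_vector.span B)"

text \<open>
  The type \<open>'a \<Rightarrow>\<^sub>L 'a\<close> consists of the bounded \<^emph>\<open>real\<close>-linear operators, with the
  operator norm; \<open>bounded_ops\<close> is the subset of complex-linear ones.
\<close>

definition bounded_ops :: "('a::complex_hilbert_space \<Rightarrow>\<^sub>L 'a) set" where
  "bounded_ops = {A. \<forall>c x. blinfun_apply A (c *\<^sub>C x) = c *\<^sub>C blinfun_apply A x}"

definition compact_ops :: "('a::complex_hilbert_space \<Rightarrow>\<^sub>L 'a) set" where
  "compact_ops = {A \<in> bounded_ops. compact (closure (blinfun_apply A ` cball 0 1))}"

text \<open>Only meaningful for \<open>A \<in> bounded_ops\<close>, where existence is the Riesz representation theorem.\<close>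

definition cadjoint :: "('a::complex_hilbert_space \<Rightarrow>\<^sub>L 'a) \<Rightarrow> ('a \<Rightarrow>\<^sub>L 'a)" where
  "cadjoint A = (THE B. \<forall>x y. cinner (blinfun_apply A x) y = cinner x (blinfun_apply B y))"

definition selfadjoint_projection :: "('a::complex_hilbert_space \<Rightarrow>\<^sub>L 'a) \<Rightarrow> bool" where
  "selfadjoint_projection P \<longleftrightarrow> P \<in> bounded_ops \<and> cadjoint P = P \<and> P o\<^sub>L P = P"

definition unitary_ops :: "('a::complex_hilbert_space \<Rightarrow>\<^sub>L 'a) set" where
  "unitary_ops = {U \<in> bounded_ops.
     cadjoint U o\<^sub>L U = id_blinfun \<and> U o\<^sub>L cadjoint U = id_blinfun}"

definition antiunitary :: "('a::complex_hilbert_space \<Rightarrow> 'a) \<Rightarrow> bool" where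
  "antiunitary C \<longleftrightarrow> bij C
     \<and> (\<forall>x y. C (x + y) = C x + C y)
     \<and> (\<forall>c x. C (c *\<^sub>C x) = cnj c *\<^sub>C C x)
     \<and> (\<forall>x y. cinner (C x) (C y) = cnj (cinner x y))"

definition local_ops :: "('a::complex_hilbert_space \<Rightarrow>\<^sub>L 'a) \<Rightarrow> ('a \<Rightarrow>\<^sub>L 'a) set" where
  "local_ops \<Lambda> = {A \<in> bounded_ops. (\<Lambda> o\<^sub>L A) - (A o\<^sub>L \<Lambda>) \<in> compact_ops}"

definition star_real_local_unitaries ::
  "('a::complex_hilbert_space \<Rightarrow>\<^sub>L 'a) \<Rightarrow> ('a \<Rightarrow> 'a) \<Rightarrow> ('a \<Rightarrow>\<^sub>L 'a) set" where
  "star_real_local_unitaries \<Lambda> C =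
     {U \<in> unitary_ops \<inter> local_ops \<Lambda>.
        blinfun_apply U \<circ> C = C \<circ> blinfun_apply (cadjoint U)}"

end

theory Submission
  imports Defs
begin

text \<open>
  The map \<open>U \<mapsto> T = C U\<close> identifies the \<open>\<star>\<close>-real unitaries with the involutions \<open>T\<close> that are symmetric
  for the real inner product and anticommute with the multiplication \<open>j\<close> by the imaginary unit, and
  \<open>1\<close> with \<open>C\<close>. If \<open>T + C\<close> is invertible, a Cayley transform joins \<open>T\<close> to \<open>C\<close>. In general, \<open>T\<close> has a
  compact perturbation \<open>T'\<close> which is an involution of the same kind that commutes exactly with \<open>\<Lambda>\<close>;
  so the negative spectral projection \<open>P\<close> of the anticommutator of \<open>T'\<close> and \<open>C\<close> also commutes with \<open>\<Lambda>\<close>, and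
  conjugating \<open>T\<close> by \<open>exp (\<theta> j P)\<close> is a path of local operators. It ends where \<open>T + C\<close> is invertible modulo
  compact operators. The kernel of \<open>T + C\<close> is then finite-dimensional, and rotating \<open>T\<close> on this
  kernel, which is a compact perturbation, makes \<open>T + C\<close> invertible.
\<close>

subsection \<open>Adjoints and orthogonal projections in a real Hilbert space\<close>

text \<open>A relation for the real inner product, so that it also covers antilinear operators such
  as \<open>C\<close> and \<open>T = C U\<close>. On complex-linear operators it agrees with
  \<open>cadjoint\<close>, as \<open>cadjoint_eq\<close> shows.\<close>

definition adjoint_pair :: "('a::real_inner \<Rightarrow>\<^sub>L 'a) \<Rightarrow> ('a \<Rightarrow>\<^sub>L 'a) \<Rightarrow> bool" where
  "adjoint_pair A B \<longleftrightarrow> (\<forall>x y. A x \<bullet> y = x \<bullet> B y)"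

lemma adjoint_pairD: "adjoint_pair A B \<Longrightarrow> A x \<bullet> y = x \<bullet> B y"
  by (simp add: adjoint_pair_def)

lemma adjoint_pair_commute: "adjoint_pair A B \<longleftrightarrow> adjoint_pair B A"
  by (metis adjoint_pair_def inner_commute)

lemma adjoint_pair_id: "adjoint_pair id_blinfun id_blinfun"
  by (simp add: adjoint_pair_def)

lemma adjoint_pair_add:
  "adjoint_pair A A' \<Longrightarrow> adjoint_pair B B' \<Longrightarrow> adjoint_pair (A + B) (A' + B')"
  by (simp add: adjoint_pair_def blinfun.bilinear_simps inner_left_distrib inner_right_distrib)

lemma adjoint_pair_diff:
  "adjoint_pair A A' \<Longrightarrow> adjoint_pair B B' \<Longrightarrow> adjoint_pair (A - B) (A' - B')"
  by (simp add: adjoint_pair_def blinfun.bilinear_simps inner_diff_left inner_diff_right)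

lemma adjoint_pair_scaleR: "adjoint_pair A A' \<Longrightarrow> adjoint_pair (r *\<^sub>R A) (r *\<^sub>R A')"
  by (simp add: adjoint_pair_def blinfun.bilinear_simps)

lemma adjoint_pair_compose:
  "adjoint_pair A A' \<Longrightarrow> adjoint_pair B B' \<Longrightarrow> adjoint_pair (A o\<^sub>L B) (B' o\<^sub>L A')"
  by (simp add: adjoint_pair_def)

section \<open>Orthogonal projections onto closed subspaces and kernels\<close>

lemma closest_point_exists_complete:
  fixes x :: "'a::{real_inner,banach}"
  assumes "closed V" and V: "subspace V"
  obtains p where "p \<in> V" "\<And>v. v \<in> V \<Longrightarrow> (x - p) \<bullet> v = 0"
proof -
  define d where "d = Inf ((\<lambda>v. (norm (x - v))\<^sup>2) ` V)"
  have ne: "V \<noteq> {}" using V by (auto simp: subspace_def)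
  have bdd: "bdd_below ((\<lambda>v. (norm (x - v))\<^sup>2) ` V)" by (intro bdd_belowI2[of _ 0]) auto
  have dle: "d \<le> (norm (x - v))\<^sup>2" if "v \<in> V" for v
    unfolding d_def by (rule cINF_lower[OF bdd that])
  have "\<exists>v\<in>V. (norm (x - v))\<^sup>2 < d + inverse (real (Suc n))" for n
  proof -
    have "d < d + inverse (real (Suc n))" by simp
    then show ?thesis unfolding d_def using cInf_lessD[of "(\<lambda>v. (norm (x - v))\<^sup>2) ` V"] ne by blast
  qed
  then obtain s where s: "\<And>n. s n \<in> V" "\<And>n. (norm (x - s n))\<^sup>2 < d + inverse (real (Suc n))"
    by metis
  \<comment> \<open>The parallelogram law for \<open>x - u\<close> and \<open>x - v\<close>; the
    midpoint of \<open>u\<close> and \<open>v\<close> lies in \<open>V\<close>, so its squared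
    distance from \<open>x\<close> is at least \<open>d\<close>. This makes a minimising sequence
    Cauchy.\<close>
  have par: "(norm (u - v))\<^sup>2 \<le> 2 * ((norm (x - u))\<^sup>2 - d) + 2 * ((norm (x - v))\<^sup>2 - d)"
    if "u \<in> V" "v \<in> V" for u v
  proof -
    have "(1/2) *\<^sub>R (u + v) \<in> V" using that V by (simp add: subspace_add subspace_scale)
    then have "d \<le> (norm (x - (1/2) *\<^sub>R (u + v)))\<^sup>2" by (rule dle)
    moreover have "(norm (u - v))\<^sup>2 + 4 * (norm (x - (1/2) *\<^sub>R (u + v)))\<^sup>2
        = 2 * (norm (x - u))\<^sup>2 + 2 * (norm (x - v))\<^sup>2"
      by (simp add: power2_norm_eq_inner algebra_simps inner_commute)
    ultimately show ?thesis by argo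
  qed
  have "Cauchy s"
  proof (rule CauchyI)
    fix e :: real assume "e > 0"
    then obtain N where N: "inverse (real (Suc N)) < e\<^sup>2 / 4"
      using reals_Archimedean[of "e\<^sup>2 / 4"] by auto
    have small: "(norm (x - s n))\<^sup>2 - d < e\<^sup>2 / 4" if "n \<ge> N" for n
    proof -
      have "inverse (real (Suc n)) \<le> inverse (real (Suc N))" using that by simp
      then show ?thesis using s(2)[of n] N by linarith
    qed
    have "norm (s m - s n) < e" if "m \<ge> N" "n \<ge> N" for m n
    proof -
      have "(norm (s m - s n))\<^sup>2 < e\<^sup>2"
        using par[OF s(1) s(1), of m n] small[OF that(1)] small[OF that(2)] by argo
      then show ?thesis using \<open>e > 0\<close> power_less_imp_less_base by fastforce
    qed
    then show "\<exists>M. \<forall>m\<ge>M. \<forall>n\<ge>M. norm (s m - s n) < e" by blast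
  qed
  then obtain p where p: "s \<longlonglongrightarrow> p" using Cauchy_convergent_iff convergent_def by blast
  have pV: "p \<in> V" using closed_sequentially[OF \<open>closed V\<close>] s(1) p by blast
  have "(norm (x - p))\<^sup>2 \<le> d"
  proof (rule LIMSEQ_le)
    show "(\<lambda>n. (norm (x - s n))\<^sup>2) \<longlonglongrightarrow> (norm (x - p))\<^sup>2" by (intro tendsto_intros p)
    show "(\<lambda>n. d + inverse (real (Suc n))) \<longlonglongrightarrow> d"
      using tendsto_add[OF tendsto_const LIMSEQ_inverse_real_of_nat, of d] by simp
    show "\<exists>N. \<forall>n\<ge>N. (norm (x - s n))\<^sup>2 \<le> d + inverse (real (Suc n))"
      using s(2) less_imp_le by blast
  qed
  have "(x - p) \<bullet> v = 0" if "v \<in> V" for v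
  proof (cases "v = 0")
    case False
    \<comment> \<open>The point of the line through \<open>p\<close> in direction \<open>v\<close>
      closest to \<open>x\<close>. It cannot beat \<open>p\<close>, which forces the inner product
      to vanish.\<close>
    define t where "t = ((x - p) \<bullet> v) / (v \<bullet> v)"
    have "p + t *\<^sub>R v \<in> V" using pV that V by (simp add: subspace_add subspace_scale)
    then have "(norm (x - p))\<^sup>2 \<le> (norm (x - (p + t *\<^sub>R v)))\<^sup>2"
      using order_trans[OF \<open>(norm (x - p))\<^sup>2 \<le> d\<close> dle] by blast
    also have "\<dots> = (norm (x - p))\<^sup>2 - 2 * t * ((x - p) \<bullet> v) + t\<^sup>2 * (v \<bullet> v)"
      unfolding power2_norm_eq_inner
      by (simp add: power2_eq_square algebra_simps inner_commute)
    also have "\<dots> = (norm (x - p))\<^sup>2 - ((x - p) \<bullet> v)\<^sup>2 / (v \<bullet> v)"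
      using False by (simp add: t_def field_simps power2_eq_square)
    finally have "((x - p) \<bullet> v)\<^sup>2 / (v \<bullet> v) \<le> 0" by simp
    then have "((x - p) \<bullet> v)\<^sup>2 \<le> 0" using False
      by (metis divide_le_0_iff inner_gt_zero_iff not_less order_refl)
    then show ?thesis by simp
  qed auto
  with pV show ?thesis using that by blast
qed

lemma orthogonal_projection_exists:
  fixes V :: "'a::{real_inner,banach} set"
  assumes "closed V" and V: "subspace V"
  obtains Q :: "'a \<Rightarrow>\<^sub>L 'a" where "adjoint_pair Q Q" "\<And>x. Q x \<in> V" "\<And>x. x \<in> V \<Longrightarrow> Q x = x"
proof -
  have "\<forall>x. \<exists>p. p \<in> V \<and> (\<forall>v\<in>V. (x - p) \<bullet> v = 0)"
    using closest_point_exists_complete[OF assms] by metis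
  then obtain q where q: "\<And>x. q x \<in> V" "\<And>x v. v \<in> V \<Longrightarrow> (x - q x) \<bullet> v = 0"
    by metis
  have uniq: "q x = p" if "p \<in> V" "\<And>v. v \<in> V \<Longrightarrow> (x - p) \<bullet> v = 0" for x p
  proof -
    have mem: "q x - p \<in> V" using q(1) that(1) V by (simp add: subspace_diff)
    have "(q x - p) \<bullet> (q x - p) = (x - p) \<bullet> (q x - p) - (x - q x) \<bullet> (q x - p)"
      by (simp add: inner_diff_left)
    also have "\<dots> = 0" using that(2)[OF mem] q(2)[OF mem] by simp
    finally show ?thesis by simp
  qed
  have "bounded_linear q"
  proof (rule bounded_linear_intro[where K=1])
    fix x y show "q (x + y) = q x + q y"
    proof (rule uniq)
      show "q x + q y \<in> V" using q(1) V by (simp add: subspace_add)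
      show "(x + y - (q x + q y)) \<bullet> v = 0" if "v \<in> V" for v
        using q(2)[OF that, of x] q(2)[OF that, of y] by (simp add: inner_diff_left inner_left_distrib)
    qed
  next
    fix r x show "q (r *\<^sub>R x) = r *\<^sub>R q x"
    proof (rule uniq)
      show "r *\<^sub>R q x \<in> V" using q(1) V by (simp add: subspace_scale)
      show "(r *\<^sub>R x - r *\<^sub>R q x) \<bullet> v = 0" if "v \<in> V" for v
        using q(2)[OF that, of x] by (simp add: inner_diff_left)
    qed
  next
    fix x
    have "q x \<bullet> q x = x \<bullet> q x" using q(2)[OF q(1), of x x] by (simp add: inner_diff_left)
    also have "\<dots> \<le> norm x * norm (q x)" by (rule norm_cauchy_schwarz)
    finally have "norm (q x) * norm (q x) \<le> norm x * norm (q x)"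
      by (simp add: power2_norm_eq_inner[symmetric] power2_eq_square)
    then show "norm (q x) \<le> norm x * 1" by (cases "q x = 0") auto
  qed
  then have ap: "blinfun_apply (Blinfun q) = q" by (rule bounded_linear_Blinfun_apply)
  show ?thesis
  proof (rule that[of "Blinfun q"])
    have "q x \<bullet> y = x \<bullet> q y" for x y
      using q(2)[OF q(1), of x y] q(2)[OF q(1), of y x]
      by (simp add: inner_diff_left inner_commute[of "q x" y] inner_commute[of "q x" "q y"])
    then show "adjoint_pair (Blinfun q) (Blinfun q)" by (simp add: adjoint_pair_def ap)
    show "Blinfun q x \<in> V" for x by (simp add: ap q)
    show "Blinfun q x = x" if "x \<in> V" for x
      using uniq[OF that, of x] by (simp add: ap)
  qed
qed

lemma kernel_projection_exists:
  fixes A :: "'a::{real_inner,banach} \<Rightarrow>\<^sub>L 'a"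
  obtains Q :: "'a \<Rightarrow>\<^sub>L 'a" where "adjoint_pair Q Q" "\<And>x. A (Q x) = 0" "\<And>x. A x = 0 \<Longrightarrow> Q x = x"
proof -
  have cl: "closed {x. A x = 0}"
    by (intro closed_Collect_eq continuous_intros)
  have sub: "subspace {x. A x = 0}"
    by (auto simp: subspace_def blinfun.bilinear_simps)
  show ?thesis
  proof (rule orthogonal_projection_exists[OF cl sub])
    fix Q :: "'a \<Rightarrow>\<^sub>L 'a"
    assume "adjoint_pair Q Q" "\<And>x. Q x \<in> {x. A x = 0}" "\<And>x. x \<in> {x. A x = 0} \<Longrightarrow> Q x = x"
    then show thesis by (intro that[of Q]) simp_all
  qed
qed

text \<open>Invariance of the kernel under both \<open>B\<close> and its adjoint makes the
  orthogonal complement of the kernel invariant as well, so \<open>B\<close> respects the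
  decomposition.\<close>

lemma kernel_projection_commute:
  fixes A Q B B' :: "'a::real_inner \<Rightarrow>\<^sub>L 'a"
  assumes Q: "adjoint_pair Q Q" "\<And>x. A (Q x) = 0" "\<And>x. A x = 0 \<Longrightarrow> Q x = x"
    and B: "adjoint_pair B B'"
    and "\<And>x. A x = 0 \<Longrightarrow> A (B x) = 0" "\<And>x. A x = 0 \<Longrightarrow> A (B' x) = 0"
  shows "Q (B x) = B (Q x)"
proof -
  have "Q (B x) \<bullet> z = B (Q x) \<bullet> z" for z
  proof -
    have "Q (B x) \<bullet> z = x \<bullet> B' (Q z)"
      using Q(1) B by (simp add: adjoint_pair_def)
    also have "B' (Q z) = Q (B' (Q z))" using Q(3)[OF assms(6)[OF Q(2)]] by simp
    also have "x \<bullet> \<dots> = B (Q x) \<bullet> Q z"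
      using Q(1) B by (simp add: adjoint_pair_def)
    also have "\<dots> = Q (B (Q x)) \<bullet> z"
      using Q(1) by (simp add: adjoint_pair_def)
    also have "Q (B (Q x)) = B (Q x)" using Q(3)[OF assms(5)[OF Q(2)]] by simp
    finally show ?thesis .
  qed
  then show ?thesis by (metis vector_eq_rdot)
qed

section \<open>Bounded inverses, Riesz representation and existence of adjoints\<close>

text \<open>The lower bound gives injectivity and a closed range. A vector orthogonal to the range
  is killed by \<open>B'\<close>, so the range is everything.\<close>

lemma bounded_below_inverse:
  fixes B :: "'a::{real_inner,banach} \<Rightarrow>\<^sub>L 'a"
  assumes adj: "adjoint_pair B B'" and c: "c > 0"
    and below: "\<And>x. c * norm x \<le> norm (B x)" and inj': "\<And>x. B' x = 0 \<Longrightarrow> x = 0"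
  obtains G :: "'a \<Rightarrow>\<^sub>L 'a" where "\<And>x. B (G x) = x" "\<And>x. G (B x) = x"
    "\<And>x. norm (G x) \<le> norm x / c"
proof -
  have inj: "inj (blinfun_apply B)"
  proof (rule injI)
    fix x y assume "B x = B y"
    then have "c * norm (x - y) \<le> 0" using below[of "x - y"] by (simp add: blinfun.bilinear_simps)
    then have "norm (x - y) \<le> 0" using c by (simp add: mult_le_0_iff)
    then show "x = y" by simp
  qed
  have "closed (range (blinfun_apply B))"
  proof (rule complete_imp_closed, rule complete_isometric_image[OF c subspace_UNIV])
    show "bounded_linear (blinfun_apply B)" by (rule blinfun.bounded_linear_right)
  qed (auto simp: below complete_UNIV)
  moreover have "subspace (range (blinfun_apply B))"
    using linear_subspace_image[OF bounded_linear.linear[OF blinfun.bounded_linear_right] subspace_UNIV] .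
  ultimately have "surj (blinfun_apply B)"
  proof -
    assume cl: "closed (range (blinfun_apply B))" "subspace (range (blinfun_apply B))"
    have "y \<in> range (blinfun_apply B)" for y
    proof -
      obtain p where p: "p \<in> range (blinfun_apply B)" "\<And>v. v \<in> range (blinfun_apply B) \<Longrightarrow> (y - p) \<bullet> v = 0"
        using closest_point_exists_complete[OF cl] by blast
      have "B x \<bullet> (y - p) = 0" for x using p(2)[of "B x"] by (simp add: inner_commute)
      then have "x \<bullet> B' (y - p) = 0" for x by (simp add: adjoint_pairD[OF adj])
      then have "B' (y - p) = 0" by (metis inner_eq_zero_iff)
      then show ?thesis using inj' p(1) by fastforce
    qed
    then show ?thesis by blast
  qed
  define g where "g = inv (blinfun_apply B)"
  have g1: "B (g x) = x" for x unfolding g_def using \<open>surj (blinfun_apply B)\<close> by (simp add: surj_f_inv_f)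
  have g2: "g (B x) = x" for x unfolding g_def using inj by simp
  have bd: "norm (g x) \<le> norm x / c" for x
    using below[of "g x"] c by (simp add: g1 field_simps)
  have "bounded_linear g"
  proof (rule bounded_linear_intro[where K="1 / c"])
    show "g (x + y) = g x + g y" for x y
      using g2[of "g x + g y"] by (simp add: blinfun.add_right g1)
    show "g (r *\<^sub>R x) = r *\<^sub>R g x" for r x
      using g2[of "r *\<^sub>R g x"] by (simp add: blinfun.scaleR_right g1)
    show "norm (g x) \<le> norm x * (1 / c)" for x using bd by simp
  qed
  then have "blinfun_apply (Blinfun g) = g" by (rule bounded_linear_Blinfun_apply)
  then show ?thesis using that[of "Blinfun g"] g1 g2 bd by metis
qed

text \<open>The kernel of a nonzero functional has codimension one, so a multiple of any nonzero
  vector \<open>u\<close> orthogonal to it represents \<open>f\<close>; the factor is fixed by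
  evaluating at \<open>u\<close>.\<close>

lemma Riesz_representation:
  fixes f :: "'a::{real_inner,banach} \<Rightarrow> real"
  assumes f: "bounded_linear f"
  obtains y where "\<And>x. f x = x \<bullet> y"
proof (cases "\<forall>x. f x = 0")
  case True then show ?thesis using that[of 0] by simp
next
  case False
  then obtain w where w: "f w \<noteq> 0" by blast
  interpret f: bounded_linear f by (rule f)
  have cl: "closed {x. f x = 0}"
    by (intro closed_Collect_eq continuous_intros f.continuous_on)
  have sub: "subspace {x. f x = 0}"
    by (auto simp: subspace_def f.add f.scaleR)
  obtain p where "p \<in> {x. f x = 0}" "\<And>v. v \<in> {x. f x = 0} \<Longrightarrow> (w - p) \<bullet> v = 0"
    using closest_point_exists_complete[OF cl sub] by blast
  then have p: "f p = 0" "\<And>v. f v = 0 \<Longrightarrow> (w - p) \<bullet> v = 0" by auto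
  define u where "u = w - p"
  have fu: "f u \<noteq> 0" using w p(1) by (simp add: u_def f.diff)
  then have uu: "u \<bullet> u \<noteq> 0" by (metis f.zero inner_eq_zero_iff)
  show ?thesis
  proof (rule that[of "(f u / (u \<bullet> u)) *\<^sub>R u"])
    fix x
    have "f (x - (f x / f u) *\<^sub>R u) = 0" using fu by (simp add: f.diff f.scaleR)
    then have "u \<bullet> (x - (f x / f u) *\<^sub>R u) = 0" using p(2) by (simp add: u_def)
    then have "u \<bullet> x = (f x / f u) * (u \<bullet> u)" by (simp add: inner_diff_right)
    then show "f x = x \<bullet> (f u / (u \<bullet> u)) *\<^sub>R u" using fu uu by (simp add: inner_commute)
  qed
qed

lemma adjoint_pair_exists:
  fixes A :: "'a::{real_inner,banach} \<Rightarrow>\<^sub>L 'a"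
  obtains B where "adjoint_pair A B"
proof -
  have "\<exists>b. \<forall>x. A x \<bullet> y = x \<bullet> b" for y
    using Riesz_representation[of "\<lambda>x. A x \<bullet> y"]
    by (metis bounded_linear_inner_left_comp blinfun.bounded_linear_right)
  then obtain b where b: "\<And>x y. A x \<bullet> y = x \<bullet> b y" by metis
  have "bounded_linear b"
  proof (rule bounded_linear_intro[where K="norm A"])
    show "b (x + y) = b x + b y" for x y
      by (subst vector_eq_ldot[symmetric]) (simp add: b[symmetric] inner_right_distrib)
    show "b (r *\<^sub>R x) = r *\<^sub>R b x" for r x
      by (subst vector_eq_ldot[symmetric]) (simp add: b[symmetric])
    fix x
    have "norm (b x) ^ 2 = A (b x) \<bullet> x" by (simp add: b power2_norm_eq_inner)
    also have "\<dots> \<le> norm (A (b x)) * norm x" by (rule norm_cauchy_schwarz)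
    also have "\<dots> \<le> norm A * norm (b x) * norm x"
      by (intro mult_right_mono norm_blinfun) auto
    finally show "norm (b x) \<le> norm x * norm A"
      by (cases "norm (b x) = 0") (auto simp: power2_eq_square mult.commute)
  qed
  then show ?thesis using that[of "Blinfun b"] b by (simp add: adjoint_pair_def bounded_linear_Blinfun_apply)
qed

subsection \<open>Absolute value and sign of a symmetric operator\<close>

text \<open>\<open>R\<close> is the positive square root of \<open>M\<^sup>2\<close>. It is a norm
  limit of polynomials in \<open>M\<^sup>2\<close>, which gives the last property: it also applies
  to operators that only anticommute with \<open>M\<close>.\<close>

lemma absolute_value_exists:
  fixes M :: "'a::{real_inner,banach} \<Rightarrow>\<^sub>L 'a"
  assumes M: "adjoint_pair M M"
  obtains R :: "'a \<Rightarrow>\<^sub>L 'a" where "adjoint_pair R R" "\<And>x. 0 \<le> R x \<bullet> x" "\<And>x. R (R x) = M (M x)"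
    "\<And>(B::'a \<Rightarrow>\<^sub>L 'a) x. (\<And>x. B (M (M x)) = M (M (B x))) \<Longrightarrow> B (R x) = R (B x)"
proof -
  \<comment> \<open>Any \<open>m\<close> that bounds the norm of \<open>M\<close> makes
    \<open>Z\<close> below a contraction; the added 1 keeps \<open>m\<close> positive when
    \<open>M = 0\<close>.\<close>
  define m where "m = norm M + 1"
  have m: "m > 0" "norm M \<le> m" unfolding m_def by (smt (verit) norm_ge_zero)+
  define Z where "Z = id_blinfun - (1 / m\<^sup>2) *\<^sub>R (M o\<^sub>L M)"
  have Z_adj: "adjoint_pair Z Z"
    unfolding Z_def by (intro adjoint_pair_diff adjoint_pair_id adjoint_pair_scaleR adjoint_pair_compose M)
  have Z_norm: "norm Z \<le> 1"
  proof (rule norm_blinfun_bound)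
    fix x
    have "norm (M (M x)) \<le> m * norm (M x)"
      using norm_blinfun[of M "M x"] m(2) by (meson mult_right_mono norm_ge_zero order_trans)
    then have "(norm (M (M x)))\<^sup>2 \<le> (m * norm (M x))\<^sup>2" by (intro power_mono) auto
    then have le: "(norm (M (M x)))\<^sup>2 / (m\<^sup>2)\<^sup>2 \<le> (norm (M x))\<^sup>2 / m\<^sup>2"
      using m(1) by (simp add: divide_simps power2_eq_square mult_ac)
    have "(norm (Z x))\<^sup>2 = (norm x)\<^sup>2 - 2 * (x \<bullet> M (M x)) / m\<^sup>2 + (norm (M (M x)))\<^sup>2 / (m\<^sup>2)\<^sup>2"
      unfolding Z_def power2_norm_eq_inner
      by (simp add: blinfun.bilinear_simps inner_diff_left inner_diff_right inner_commute power2_eq_square)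
    also have "x \<bullet> M (M x) = (norm (M x))\<^sup>2"
      by (simp add: adjoint_pairD[OF M, symmetric] power2_norm_eq_inner)
    finally have "(norm (Z x))\<^sup>2 \<le> (norm x)\<^sup>2" using le m(1)
      by (smt (verit) divide_nonneg_nonneg zero_le_power2 add_divide_distrib)
    then show "norm (Z x) \<le> 1 * norm x" by (simp add: power2_le_iff_abs_le)
  qed simp
  \<comment> \<open>The iterates approximate \<open>1 - sqrt (1 - Z)\<close>. They are dominated in norm by the scalar iterates \<open>a\<close> for
    \<open>Z = 1\<close>, whose convergence makes them a Cauchy sequence.\<close>
  define A where "A = rec_nat 0 (\<lambda>_ X. (1/2) *\<^sub>R (Z + (X o\<^sub>L X)))"
  define a where "a = rec_nat (0::real) (\<lambda>_ y. (1 + y * y) / 2)"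
  have A0: "A 0 = 0" and AS: "A (Suc n) = (1/2) *\<^sub>R (Z + (A n o\<^sub>L A n))" for n by (simp_all add: A_def)
  have a0: "a 0 = 0" and aS: "a (Suc n) = (1 + a n * a n) / 2" for n by (simp_all add: a_def)
  have A_comm: "B (A n x) = A n (B x)" if "\<And>x. B (Z x) = Z (B x)" for B :: "'a \<Rightarrow>\<^sub>L 'a" and n x
    by (induction n arbitrary: x) (simp_all add: A0 AS blinfun.bilinear_simps that)
  have AZ: "A n (Z x) = Z (A n x)" for n x using A_comm[of Z] by simp
  have AA: "A n (A k x) = A k (A n x)" for n k x by (rule A_comm) (rule AZ)
  have A_adj: "adjoint_pair (A n) (A n)" for n
  proof (induction n)
    case 0 show ?case by (simp add: A0 adjoint_pair_def)
  next
    case (Suc n) then show ?case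
      unfolding AS by (intro adjoint_pair_scaleR adjoint_pair_add adjoint_pair_compose Z_adj)
  qed
  have a_bd: "0 \<le> a n \<and> a n \<le> 1" for n
  proof (induction n)
    case (Suc n) then show ?case using mult_le_one[of "a n" "a n"] by (simp add: aS)
  qed (simp add: a0)
  have A_norm: "norm (A n) \<le> a n" for n
  proof (induction n)
    case (Suc n)
    have "norm (A n o\<^sub>L A n) \<le> a n * a n"
      using norm_blinfun_compose[of "A n" "A n"] mult_mono[OF Suc Suc] a_bd[of n] by force
    then show ?case
      using norm_triangle_ineq[of Z "A n o\<^sub>L A n"] Z_norm by (simp add: AS aS)
  qed (simp add: A0 a0)
  \<comment> \<open>The iterates commute, so a difference of two squares factors, and the bounds by
    \<open>a\<close> turn the factors into those of the same identity for scalars.\<close>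
  have diff: "norm (A (Suc n) - A n) \<le> a (Suc n) - a n" for n
  proof (induction n)
    case 0 then show ?case using Z_norm by (simp add: AS A0 aS a0)
  next
    case (Suc n)
    have "A (Suc (Suc n)) - A (Suc n) = (1/2) *\<^sub>R ((A (Suc n) o\<^sub>L A (Suc n)) - (A n o\<^sub>L A n))"
      unfolding AS[of "Suc n"] by (subst (3) AS) (simp add: algebra_simps)
    also have "\<dots> = (1/2) *\<^sub>R ((A (Suc n) - A n) o\<^sub>L (A (Suc n) + A n))"
      by (intro arg_cong[where f="scaleR (1/2)"] blinfun_eqI)
        (simp add: blinfun.bilinear_simps AA[of "Suc n" n])
    finally have eq: "norm (A (Suc (Suc n)) - A (Suc n)) = 1/2 * norm ((A (Suc n) - A n) o\<^sub>L (A (Suc n) + A n))"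
      by simp
    have "norm ((A (Suc n) - A n) o\<^sub>L (A (Suc n) + A n)) \<le> norm (A (Suc n) - A n) * norm (A (Suc n) + A n)"
      by (rule norm_blinfun_compose)
    also have "\<dots> \<le> (a (Suc n) - a n) * (a (Suc n) + a n)"
      using Suc A_norm[of n] A_norm[of "Suc n"] norm_triangle_ineq[of "A (Suc n)" "A n"]
        order_trans[OF norm_ge_zero Suc]
      by (intro mult_mono) auto
    finally have "norm (A (Suc (Suc n)) - A (Suc n)) \<le> 1/2 * ((a (Suc n) - a n) * (a (Suc n) + a n))"
      unfolding eq by simp
    also have "2 * a (Suc n) = 1 + a n * a n" by (simp add: aS)
    then have "1/2 * ((a (Suc n) - a n) * (a (Suc n) + a n)) = a (Suc (Suc n)) - a (Suc n)"
      unfolding aS[of "Suc n"] by (simp add: field_simps)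
    finally show ?case .
  qed
  have "convergent A"
  proof -
    have inc: "incseq a"
      by (rule incseq_SucI) (meson diff norm_ge_zero order_trans diff_ge_0_iff_ge)
    then obtain l where "a \<longlonglongrightarrow> l"
      using incseq_convergent[of a 1] a_bd by blast
    then have "summable (\<lambda>n. a (Suc n) - a n)" by (rule telescope_summable)
    then have "summable (\<lambda>n. A (Suc n) - A n)"
      by (rule summable_comparison_test[rotated]) (use diff in auto)
    then have "convergent (\<lambda>n. \<Sum>i<n. A (Suc i) - A i)" by (simp add: summable_iff_convergent)
    then show ?thesis by (simp add: sum_lessThan_telescope A0)
  qed
  then obtain L where L: "A \<longlonglongrightarrow> L" by (auto simp: convergent_def)
  have L_ap: "(\<lambda>n. A n x) \<longlonglongrightarrow> L x" for x by (intro tendsto_intros L)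
  have L_adj: "adjoint_pair L L" unfolding adjoint_pair_def
  proof (intro allI)
    fix x y
    have "(\<lambda>n. A n x \<bullet> y) \<longlonglongrightarrow> L x \<bullet> y" by (intro tendsto_intros L_ap)
    moreover have "(\<lambda>n. A n x \<bullet> y) \<longlonglongrightarrow> x \<bullet> L y"
      unfolding adjoint_pairD[OF A_adj] by (intro tendsto_intros L_ap)
    ultimately show "L x \<bullet> y = x \<bullet> L y" by (rule LIMSEQ_unique)
  qed
  \<comment> \<open>The fixed point equation says that \<open>1 - L\<close> squares to
    \<open>1 - Z\<close>, which is \<open>M\<^sup>2 / m\<^sup>2\<close>; hence \<open>R\<close> will
    be \<open>m\<close> times \<open>1 - L\<close>. Positivity comes from
    \<open>L_norm\<close>.\<close>
  have L_eq: "L = (1/2) *\<^sub>R (Z + (L o\<^sub>L L))"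
  proof (rule LIMSEQ_unique)
    show "(\<lambda>n. A (Suc n)) \<longlonglongrightarrow> L" using L by (rule LIMSEQ_Suc)
    show "(\<lambda>n. A (Suc n)) \<longlonglongrightarrow> (1/2) *\<^sub>R (Z + (L o\<^sub>L L))"
      unfolding AS by (intro tendsto_intros L)
  qed
  have L_norm: "norm L \<le> 1"
    using LIMSEQ_le_const2[OF tendsto_norm[OF L], of 1] A_norm a_bd by (meson order_trans)
  show ?thesis
  proof (rule that[of "m *\<^sub>R (id_blinfun - L)"])
    show "adjoint_pair (m *\<^sub>R (id_blinfun - L)) (m *\<^sub>R (id_blinfun - L))"
      by (intro adjoint_pair_scaleR adjoint_pair_diff adjoint_pair_id L_adj)
    fix x
    have "L x \<bullet> x \<le> norm (L x) * norm x" by (rule norm_cauchy_schwarz)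
    also have "norm (L x) \<le> norm x"
      using norm_blinfun[of L x] mult_right_mono[OF L_norm, of "norm x"] by simp
    then have "norm (L x) * norm x \<le> norm x * norm x" by (rule mult_right_mono) simp
    finally have "L x \<bullet> x \<le> x \<bullet> x" by (simp add: power2_norm_eq_inner[symmetric] power2_eq_square)
    then show "0 \<le> (m *\<^sub>R (id_blinfun - L)) x \<bullet> x"
      using m(1) by (simp add: blinfun.bilinear_simps inner_diff_left)
    have "L x = (1/2) *\<^sub>R (Z x + L (L x))"
      using arg_cong[OF L_eq, of "\<lambda>f. f x"] by (simp add: blinfun.bilinear_simps)
    then have "L x + L x = Z x + L (L x)" by (metis scaleR_half_double scaleR_right_distrib)
    then have "x - L x - (L x - L (L x)) = x - Z x" by (metis add_diff_cancel_left' add_diff_eq diff_diff_eq2 diff_diff_eq)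
    then have "m\<^sup>2 *\<^sub>R (x - L x - (L x - L (L x))) = M (M x)"
      using m(1) by (simp add: Z_def blinfun.bilinear_simps)
    then show "(m *\<^sub>R (id_blinfun - L)) ((m *\<^sub>R (id_blinfun - L)) x) = M (M x)"
      by (simp add: blinfun.bilinear_simps power2_eq_square algebra_simps)
    fix B :: "'a \<Rightarrow>\<^sub>L 'a"
    assume B: "\<And>x. B (M (M x)) = M (M (B x))"
    have "B (Z x) = Z (B x)" for x by (simp add: Z_def blinfun.bilinear_simps B)
    then have eq: "B (A n x) = A n (B x)" for n by (rule A_comm)
    have "(\<lambda>n. B (A n x)) \<longlonglongrightarrow> B (L x)" by (intro tendsto_intros L_ap)
    moreover have "(\<lambda>n. B (A n x)) \<longlonglongrightarrow> L (B x)" unfolding eq by (rule L_ap)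
    ultimately have "B (L x) = L (B x)" by (rule LIMSEQ_unique)
    then show "B ((m *\<^sub>R (id_blinfun - L)) x) = (m *\<^sub>R (id_blinfun - L)) (B x)"
      by (simp add: blinfun.bilinear_simps)
  qed
qed

text \<open>
  \<open>\<sigma>\<close> is the reflection \<open>- 1\<close> on the kernel of \<open>R + M\<close> and \<open>1\<close> on its orthogonal complement: \<open>M\<close> equals
  \<open>- R\<close> on the former, and \<open>R\<close> on the latter because \<open>(R + M) (M - R) = 0\<close>.
\<close>

lemma sign_exists:
  fixes M :: "'a::{real_inner,banach} \<Rightarrow>\<^sub>L 'a"
  assumes M: "adjoint_pair M M"
  obtains R \<sigma> :: "'a \<Rightarrow>\<^sub>L 'a" where
    "adjoint_pair R R" "\<And>x. 0 \<le> R x \<bullet> x" "\<And>x. R (R x) = M (M x)"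
    "adjoint_pair \<sigma> \<sigma>" "\<And>x. \<sigma> (\<sigma> x) = x" "\<And>x. \<sigma> (R x) = M x" "\<And>x. R (\<sigma> x) = M x"
    "\<And>(B::'a \<Rightarrow>\<^sub>L 'a) x. (\<And>x. B (M (M x)) = M (M (B x))) \<Longrightarrow> B (R x) = R (B x)"
    "\<And>(B::'a \<Rightarrow>\<^sub>L 'a) B' x. adjoint_pair B B' \<Longrightarrow> (\<And>x. B (M x) = M (B x)) \<Longrightarrow> (\<And>x. B' (M x) = M (B' x)) \<Longrightarrow>
      \<sigma> (B x) = B (\<sigma> x)"
proof -
  obtain R where R: "adjoint_pair R R" "\<And>x. 0 \<le> R x \<bullet> x" "\<And>x. R (R x) = M (M x)"
    and comm: "\<And>(B::'a \<Rightarrow>\<^sub>L 'a) x. (\<And>x. B (M (M x)) = M (M (B x))) \<Longrightarrow> B (R x) = R (B x)"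
    using absolute_value_exists[OF M] by blast
  have MR: "M (R x) = R (M x)" for x by (rule comm) simp
  obtain Q where Q: "adjoint_pair Q Q" "\<And>x. (R + M) (Q x) = 0" "\<And>x. (R + M) x = 0 \<Longrightarrow> Q x = x"
    using kernel_projection_exists[of "R + M"] by blast
  define \<sigma> where "\<sigma> = id_blinfun - 2 *\<^sub>R Q"
  have \<sigma>: "\<sigma> x = x - 2 *\<^sub>R Q x" for x by (simp add: \<sigma>_def blinfun.bilinear_simps)
  have \<sigma>_adj: "adjoint_pair \<sigma> \<sigma>" unfolding \<sigma>_def
    by (intro adjoint_pair_diff adjoint_pair_id adjoint_pair_scaleR Q)
  have MQ: "M (Q x) = - R (Q x)" for x
    using Q(2)[of x] by (simp add: blinfun.bilinear_simps add_eq_0_iff)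
  have M1: "M (x - Q x) = R (x - Q x)" for x
  proof -
    have "(M (x - Q x) - R (x - Q x)) \<bullet> z = 0" for z
    proof -
      have "(R + M) (M z - R z) = 0" by (simp add: blinfun.bilinear_simps MR R(3))
      then have "Q (M z - R z) = M z - R z" by (rule Q(3))
      then have "(x - Q x) \<bullet> (M z - R z) = 0"
        using adjoint_pairD[OF Q(1), of x "M z - R z"] by (simp add: inner_diff_left)
      then show ?thesis
        by (simp add: inner_diff_left inner_diff_right adjoint_pairD[OF M] adjoint_pairD[OF R(1)])
    qed
    then show ?thesis by (metis inner_eq_zero_iff eq_iff_diff_eq_0)
  qed
  have R\<sigma>: "R (\<sigma> x) = M x" for x
    using M1[of x] MQ[of x] by (simp add: \<sigma> blinfun.bilinear_simps scaleR_2 algebra_simps)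
  \<comment> \<open>This takes adjoints in \<open>R \<sigma> = M\<close>, all three operators being
    symmetric.\<close>
  have "\<sigma> (R x) \<bullet> z = M x \<bullet> z" for x z
    by (simp add: adjoint_pairD[OF \<sigma>_adj] adjoint_pairD[OF R(1)] R\<sigma> adjoint_pairD[OF M])
  then have \<sigma>R: "\<sigma> (R x) = M x" for x by (metis vector_eq_rdot)
  have QQ: "Q (Q x) = Q x" for x using Q(3)[OF Q(2)] .
  show ?thesis
  proof (rule that[OF R \<sigma>_adj _ \<sigma>R R\<sigma> comm])
    show "\<sigma> (\<sigma> x) = x" for x by (simp add: \<sigma> blinfun.bilinear_simps QQ scaleR_2)
    fix B B' :: "'a \<Rightarrow>\<^sub>L 'a" and x
    assume B: "adjoint_pair B B'" "\<And>x. B (M x) = M (B x)" "\<And>x. B' (M x) = M (B' x)"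
    have BR: "B (R x) = R (B x)" for x by (rule comm) (simp add: B)
    have BR': "B' (R x) = R (B' x)" for x by (rule comm) (simp add: B)
    have "Q (B x) = B (Q x)"
    proof (rule kernel_projection_commute[OF Q B(1)])
      show "(R + M) (B x) = 0" if "(R + M) x = 0" for x
        using arg_cong[OF that, of B] by (simp add: blinfun.bilinear_simps BR B)
      show "(R + M) (B' x) = 0" if "(R + M) x = 0" for x
        using arg_cong[OF that, of B'] by (simp add: blinfun.bilinear_simps BR' B)
    qed
    then show "\<sigma> (B x) = B (\<sigma> x)" by (simp add: \<sigma> blinfun.bilinear_simps)
  qed
qed

text \<open>The relation holds on the range of \<open>R\<close>, where \<sigma> is given by
  \<open>M\<close>. That range is dense because \<open>R\<close> is symmetric and injective; in
  place of a density argument, the adjoint relation shows that \<open>R\<close> kills the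
  defect.\<close>

lemma sign_anticommute:
  fixes M R \<sigma> j :: "'a::{real_inner,banach} \<Rightarrow>\<^sub>L 'a"
  assumes R: "adjoint_pair R R" and \<sigma>: "adjoint_pair \<sigma> \<sigma>" and "\<And>x. \<sigma> (R x) = M x"
    and jR: "\<And>x. j (R x) = R (j x)" and "\<And>x. M (j x) = - j (M x)" and j: "adjoint_pair j (- j)"
    and inj: "\<And>x. R x = 0 \<Longrightarrow> x = 0"
  shows "\<sigma> (j x) = - j (\<sigma> x)"
proof -
  have *: "\<sigma> (j (R x)) = - j (\<sigma> (R x))" for x
    using assms(5)[of x] by (simp add: assms(3) jR)
  have "R (\<sigma> (j x) + j (\<sigma> x)) \<bullet> z = 0" for z
  proof -
    have "R (\<sigma> (j x) + j (\<sigma> x)) \<bullet> z = - (x \<bullet> (j (\<sigma> (R z)) + \<sigma> (j (R z))))"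
      by (simp add: adjoint_pairD[OF R] adjoint_pairD[OF \<sigma>] adjoint_pairD[OF j] blinfun.bilinear_simps
          inner_left_distrib inner_right_distrib)
    then show ?thesis by (simp add: *)
  qed
  then have "R (\<sigma> (j x) + j (\<sigma> x)) = 0" by (metis inner_eq_zero_iff)
  then show ?thesis using inj eq_neg_iff_add_eq_0 by blast
qed

subsection \<open>Compact operators\<close>

text \<open>Complex linearity is left out, unlike in \<open>compact_ops\<close>, because differences
  of antilinear operators have to be compact too.\<close>

definition compact_op :: "('a::real_normed_vector \<Rightarrow>\<^sub>L 'b::real_normed_vector) \<Rightarrow> bool" where
  "compact_op A \<longleftrightarrow> compact (closure (blinfun_apply A ` cball 0 1))"

lemma compact_opI:
  assumes "blinfun_apply A ` cball 0 1 \<subseteq> S" "compact S"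
  shows "compact_op A"
proof -
  have "closure (blinfun_apply A ` cball 0 1) \<subseteq> S"
    using assms by (simp add: closure_minimal compact_imp_closed)
  then show ?thesis unfolding compact_op_def
    by (metis assms(2) closed_closure compact_Int_closed inf.absorb_iff2)
qed

lemma compact_op_add: "compact_op A \<Longrightarrow> compact_op B \<Longrightarrow> compact_op (A + B)"
proof (rule compact_opI)
  assume "compact_op A" "compact_op B"
  then show "compact {x + y | x y. x \<in> closure (blinfun_apply A ` cball 0 1) \<and> y \<in> closure (blinfun_apply B ` cball 0 1)}"
    unfolding compact_op_def by (rule compact_sums)
  show "blinfun_apply (A + B) ` cball 0 1 \<subseteq> {x + y | x y. x \<in> closure (blinfun_apply A ` cball 0 1) \<and> y \<in> closure (blinfun_apply B ` cball 0 1)}"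
  proof clarsimp
    fix x :: 'a assume "norm x \<le> 1"
    then have "A x \<in> closure (blinfun_apply A ` cball 0 1)" "B x \<in> closure (blinfun_apply B ` cball 0 1)"
      by (auto intro!: subsetD[OF closure_subset])
    then show "\<exists>u v. (A + B) x = u + v \<and> u \<in> closure (blinfun_apply A ` cball 0 1)
        \<and> v \<in> closure (blinfun_apply B ` cball 0 1)"
      using blinfun.add_left by blast
  qed
qed

lemma compact_op_compose_left: "compact_op A \<Longrightarrow> compact_op (B o\<^sub>L A)"
proof (rule compact_opI)
  assume "compact_op A"
  then show "compact (blinfun_apply B ` closure (blinfun_apply A ` cball 0 1))" unfolding compact_op_def
    by (intro compact_continuous_image continuous_intros)
  show "blinfun_apply (B o\<^sub>L A) ` cball 0 1 \<subseteq> blinfun_apply B ` closure (blinfun_apply A ` cball 0 1)"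
    using closure_subset[of "blinfun_apply A ` cball 0 1"] by auto
qed

lemma compact_op_scaleR: "compact_op A \<Longrightarrow> compact_op (r *\<^sub>R A)"
proof (rule compact_opI)
  assume "compact_op A"
  then show "compact ((\<lambda>x. r *\<^sub>R x) ` closure (blinfun_apply A ` cball 0 1))" unfolding compact_op_def
    by (rule compact_scaling)
  show "blinfun_apply (r *\<^sub>R A) ` cball 0 1 \<subseteq> (\<lambda>x. r *\<^sub>R x) ` closure (blinfun_apply A ` cball 0 1)"
    using closure_subset[of "blinfun_apply A ` cball 0 1"] by (auto simp: blinfun.bilinear_simps)
qed

lemma compact_op_minus: "compact_op A \<Longrightarrow> compact_op (- A)"
  using compact_op_scaleR[of A "-1"] by simp

lemma compact_op_diff: "compact_op A \<Longrightarrow> compact_op B \<Longrightarrow> compact_op (A - B)"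
  using compact_op_add[of A "- B"] compact_op_minus[of B] by simp

lemma compact_op_compose_right:
  assumes "compact_op A" shows "compact_op (A o\<^sub>L B)"
proof (rule compact_opI)
  \<comment> \<open>A radius of a ball containing the image of the unit ball under \<open>B\<close>;
    the added 1 makes it positive, so that dividing by it is possible.\<close>
  let ?r = "norm B + 1"
  show "compact ((\<lambda>x. ?r *\<^sub>R x) ` closure (blinfun_apply A ` cball 0 1))"
    using assms unfolding compact_op_def by (rule compact_scaling)
  show "blinfun_apply (A o\<^sub>L B) ` cball 0 1 \<subseteq> (\<lambda>x. ?r *\<^sub>R x) ` closure (blinfun_apply A ` cball 0 1)"
  proof
    fix y assume "y \<in> blinfun_apply (A o\<^sub>L B) ` cball 0 1"
    then obtain x where x: "norm x \<le> 1" "y = A (B x)" by auto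
    have r: "?r > 0" by (smt (verit) norm_ge_zero)
    have "norm (B x) \<le> ?r"
      using norm_blinfun[of B x] mult_left_mono[OF x(1), of "norm B"] by simp
    then have "(1 / ?r) *\<^sub>R B x \<in> cball 0 1" using r by (simp add: field_simps)
    then have "A ((1 / ?r) *\<^sub>R B x) \<in> closure (blinfun_apply A ` cball 0 1)"
      by (intro subsetD[OF closure_subset] imageI)
    moreover have "y = ?r *\<^sub>R A ((1 / ?r) *\<^sub>R B x)" using r x(2) by (simp add: blinfun.bilinear_simps)
    ultimately show "y \<in> (\<lambda>x. ?r *\<^sub>R x) ` closure (blinfun_apply A ` cball 0 1)" by blast
  qed
qed

lemma compact_op_zero: "compact_op 0"
  by (rule compact_opI[of _ "{0}"]) auto

lemma compact_op_sum: "(\<And>e. e \<in> E \<Longrightarrow> compact_op (f e)) \<Longrightarrow> compact_op (sum f E)"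
  by (induction E rule: infinite_finite_induct) (auto intro: compact_op_add compact_op_zero)

section \<open>Compact perturbations of invertible operators, and rank-one operators\<close>

lemma compact_op_convergent_subseq:
  assumes "compact_op A" "\<And>n::nat. norm (x n) \<le> 1"
  obtains r l where "strict_mono r" "(\<lambda>n. A (x (r n))) \<longlonglongrightarrow> l"
proof -
  have "\<And>n. A (x n) \<in> closure (blinfun_apply A ` cball 0 1)" using assms(2) closure_subset by fastforce
  then show ?thesis
    using seq_compactE[OF compact_imp_seq_compact[OF assms(1)[unfolded compact_op_def]], of "\<lambda>n. A (x n)"]
    using that by (auto simp: o_def)
qed

text \<open>Otherwise \<open>A\<close> tends to 0 along some unit vectors. By compactness
  \<open>A - B\<close>, hence \<open>B\<close>, converges on a subsequence, and the left inverse
  \<open>H\<close> carries this over to the vectors themselves. Their limit is a unit vector in the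
  kernel of \<open>A\<close>.\<close>

lemma bounded_below_if_injective:
  fixes A B H :: "'a::real_normed_vector \<Rightarrow>\<^sub>L 'a"
  assumes comp: "compact_op (A - B)" and H: "\<And>x. H (B x) = x" and inj: "\<And>x. A x = 0 \<Longrightarrow> x = 0"
  obtains c where "c > 0" "\<And>x. c * norm x \<le> norm (A x)"
proof (rule ccontr)
  assume contr: "\<not> thesis"
  have "\<exists>x. norm x = 1 \<and> norm (A x) < inverse (real (Suc n))" for n
  proof -
    have "\<not> (\<forall>x. inverse (real (Suc n)) * norm x \<le> norm (A x))"
      using that[of "inverse (real (Suc n))"] contr by auto
    then obtain x where x: "norm (A x) < inverse (real (Suc n)) * norm x" by (auto simp: not_le)
    then have "x \<noteq> 0" by auto
    then have "norm (x /\<^sub>R norm x) = 1" "norm (A (x /\<^sub>R norm x)) < inverse (real (Suc n))"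
      using x by (simp_all add: blinfun.bilinear_simps field_simps)
    then show ?thesis by blast
  qed
  then obtain x where x: "\<And>n. norm (x n) = 1" "\<And>n. norm (A (x n)) < inverse (real (Suc n))" by metis
  obtain r l where r: "strict_mono r" and l: "(\<lambda>n. (A - B) (x (r n))) \<longlonglongrightarrow> l"
    using compact_op_convergent_subseq[OF comp, of x] x(1) by (metis order_refl)
  have "(\<lambda>n. A (x n)) \<longlonglongrightarrow> 0"
    by (rule Lim_null_comparison[OF always_eventually LIMSEQ_inverse_real_of_nat])
      (use x(2) less_imp_le in blast)
  then have Ax: "(\<lambda>n. A (x (r n))) \<longlonglongrightarrow> 0" using LIMSEQ_subseq_LIMSEQ[OF _ r, of "\<lambda>n. A (x n)" 0] by (simp add: o_def)
  have "(\<lambda>n. H (A (x (r n)) - (A - B) (x (r n)))) \<longlonglongrightarrow> H (0 - l)"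
    by (intro tendsto_intros Ax l)
  then have lim: "(\<lambda>n. x (r n)) \<longlonglongrightarrow> H (0 - l)" by (simp add: blinfun.bilinear_simps H)
  then have "(\<lambda>n. A (x (r n))) \<longlonglongrightarrow> A (H (0 - l))" by (intro tendsto_intros)
  then have "A (H (0 - l)) = 0" using Ax LIMSEQ_unique by blast
  then have "H (0 - l) = 0" by (rule inj)
  moreover have "(\<lambda>n. norm (x (r n))) \<longlonglongrightarrow> norm (H (0 - l))" using lim by (rule tendsto_norm)
  ultimately show False using x(1) by (simp add: LIMSEQ_const_iff)
qed

text \<open>For a unit vector this is the projection onto its real line, not its complex line, so
  that \<open>e\<close> and \<open>j e\<close> can be given opposite signs later.\<close>

definition rank_one :: "'a::real_inner \<Rightarrow> 'a \<Rightarrow>\<^sub>L 'a" where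
  "rank_one e = Blinfun (\<lambda>x. (e \<bullet> x) *\<^sub>R e)"

lemma rank_one_apply [simp]: "rank_one e x = (e \<bullet> x) *\<^sub>R e"
  unfolding rank_one_def by (subst bounded_linear_Blinfun_apply) (auto intro!: bounded_linear_intros)

lemma compact_op_rank_one: "compact_op (rank_one e)"
proof (rule compact_opI)
  show "compact ((\<lambda>t. t *\<^sub>R e) ` {- norm e .. norm e})"
    by (intro compact_continuous_image continuous_intros compact_Icc)
  show "blinfun_apply (rank_one e) ` cball 0 1 \<subseteq> (\<lambda>t. t *\<^sub>R e) ` {- norm e .. norm e}"
  proof clarsimp
    fix x :: 'a assume "norm x \<le> 1"
    then have "\<bar>e \<bullet> x\<bar> \<le> norm e"
      using Cauchy_Schwarz_ineq2[of e x] mult_left_mono[of "norm x" 1 "norm e"] by auto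
    then show "(e \<bullet> x) *\<^sub>R e \<in> (\<lambda>t. t *\<^sub>R e) ` {- norm e..norm e}"
      by (intro imageI) (simp add: abs_le_iff minus_le_iff)
  qed
qed

subsection \<open>Local conjugations\<close>

text \<open>Multiplication by the imaginary unit enters as a bounded real operator \<open>j\<close>,
  so that linear and antilinear operators live in one type and differ only in commuting or
  anticommuting with \<open>j\<close>.\<close>

locale graded_structure =
  fixes j \<Lambda> :: "'a::{real_inner,banach} \<Rightarrow>\<^sub>L 'a"
  assumes j_adj: "adjoint_pair j (- j)" and jj: "j (j x) = - x"
    and \<Lambda>_adj: "adjoint_pair \<Lambda> \<Lambda>" and \<Lambda>\<Lambda>: "\<Lambda> (\<Lambda> x) = \<Lambda> x" and \<Lambda>j: "\<Lambda> (j x) = j (\<Lambda> x)"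
begin

definition local_op :: "('a \<Rightarrow>\<^sub>L 'a) \<Rightarrow> bool" where
  "local_op A \<longleftrightarrow> compact_op ((\<Lambda> o\<^sub>L A) - (A o\<^sub>L \<Lambda>))"

lemma local_op_commute:
  fixes A :: "'a \<Rightarrow>\<^sub>L 'a"
  assumes "\<And>x. \<Lambda> (A x) = A (\<Lambda> x)"
  shows "local_op A"
proof -
  have "(\<Lambda> o\<^sub>L A) - (A o\<^sub>L \<Lambda>) = 0"
    by (intro blinfun_eqI) (simp add: blinfun.bilinear_simps assms)
  then show ?thesis by (simp add: local_op_def compact_op_zero)
qed

lemma local_op_compact: "compact_op A \<Longrightarrow> local_op A"
  unfolding local_op_def
  by (intro compact_op_diff compact_op_compose_left compact_op_compose_right)

lemma local_op_add: "local_op A \<Longrightarrow> local_op B \<Longrightarrow> local_op (A + B)"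
proof -
  assume "local_op A" "local_op B"
  moreover have "(\<Lambda> o\<^sub>L (A + B)) - ((A + B) o\<^sub>L \<Lambda>)
      = ((\<Lambda> o\<^sub>L A) - (A o\<^sub>L \<Lambda>)) + ((\<Lambda> o\<^sub>L B) - (B o\<^sub>L \<Lambda>))"
    by (intro blinfun_eqI) (simp add: blinfun.bilinear_simps)
  ultimately show ?thesis unfolding local_op_def by (simp add: compact_op_add)
qed

lemma local_op_scaleR: "local_op A \<Longrightarrow> local_op (r *\<^sub>R A)"
proof -
  assume "local_op A"
  moreover have "(\<Lambda> o\<^sub>L (r *\<^sub>R A)) - ((r *\<^sub>R A) o\<^sub>L \<Lambda>) = r *\<^sub>R ((\<Lambda> o\<^sub>L A) - (A o\<^sub>L \<Lambda>))"
    by (intro blinfun_eqI) (simp add: blinfun.bilinear_simps algebra_simps)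
  ultimately show ?thesis unfolding local_op_def by (simp add: compact_op_scaleR)
qed

lemma local_op_diff: "local_op A \<Longrightarrow> local_op B \<Longrightarrow> local_op (A - B)"
  using local_op_add[of A "- B"] local_op_scaleR[of B "-1"] by simp

lemma local_op_compose: "local_op A \<Longrightarrow> local_op B \<Longrightarrow> local_op (A o\<^sub>L B)"
proof -
  assume "local_op A" "local_op B"
  moreover have "(\<Lambda> o\<^sub>L (A o\<^sub>L B)) - ((A o\<^sub>L B) o\<^sub>L \<Lambda>)
      = (((\<Lambda> o\<^sub>L A) - (A o\<^sub>L \<Lambda>)) o\<^sub>L B) + (A o\<^sub>L ((\<Lambda> o\<^sub>L B) - (B o\<^sub>L \<Lambda>)))"
    by (intro blinfun_eqI) (simp add: blinfun.bilinear_simps)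
  ultimately show ?thesis unfolding local_op_def
    by (simp add: compact_op_add compact_op_compose_left compact_op_compose_right)
qed

text \<open>The commutator of an inverse is \<open>- G [\<Lambda>, A] G\<close>, and compact
  operators form an ideal.\<close>

lemma local_op_inverse:
  fixes A G :: "'a \<Rightarrow>\<^sub>L 'a"
  assumes "local_op A" and AG: "\<And>x. A (G x) = x" and GA: "\<And>x. G (A x) = x"
  shows "local_op G"
proof -
  have "(\<Lambda> o\<^sub>L G) - (G o\<^sub>L \<Lambda>) = - (G o\<^sub>L (((\<Lambda> o\<^sub>L A) - (A o\<^sub>L \<Lambda>)) o\<^sub>L G))"
    by (intro blinfun_eqI) (simp add: blinfun.bilinear_simps AG GA)
  then show ?thesis using assms(1) unfolding local_op_def
    by (simp add: compact_op_minus compact_op_compose_left compact_op_compose_right)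
qed

text \<open>Symmetric involutions are isometric, so these are the local antiunitary conjugations,
  that is, the local real structures of the space.\<close>

definition conj_ops :: "('a \<Rightarrow>\<^sub>L 'a) set" where
  "conj_ops = {T. adjoint_pair T T \<and> (\<forall>x. T (T x) = x) \<and> (\<forall>x. T (j x) = - j (T x)) \<and> local_op T}"

lemma conj_opsI:
  fixes T :: "'a \<Rightarrow>\<^sub>L 'a"
  shows
  "adjoint_pair T T \<Longrightarrow> (\<And>x. T (T x) = x) \<Longrightarrow> (\<And>x. T (j x) = - j (T x)) \<Longrightarrow> local_op T \<Longrightarrow> T \<in> conj_ops"
  by (simp add: conj_ops_def)

lemma conj_opsD:
  fixes T :: "'a \<Rightarrow>\<^sub>L 'a"
  assumes "T \<in> conj_ops"
  shows "adjoint_pair T T" "T (T x) = x" "T (j x) = - j (T x)" "local_op T"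
  using assms by (simp_all add: conj_ops_def)

lemma inner_j_self: "x \<bullet> j x = 0"
  using adjoint_pairD[OF j_adj, of x x] by (simp add: blinfun.bilinear_simps inner_commute)

section \<open>Removing a finite-dimensional kernel and commuting with \<Lambda>\<close>

text \<open>The two inner product conditions together express orthogonality over the complex
  numbers. The vectors are homogeneous for \<Lambda> so that the perturbation built from them
  commutes with \<Lambda>.\<close>

definition real_orthonormal_kernel :: "('a \<Rightarrow>\<^sub>L 'a) \<Rightarrow> 'a set \<Rightarrow> bool" where
  "real_orthonormal_kernel M E \<longleftrightarrow> finite E \<and>
    (\<forall>e\<in>E. M e = 0 \<and> norm e = 1 \<and> (\<Lambda> e = e \<or> \<Lambda> e = 0)) \<and>
    (\<forall>e\<in>E. \<forall>f\<in>E. (e \<noteq> f \<longrightarrow> e \<bullet> f = 0) \<and> e \<bullet> j f = 0)"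

text \<open>Unit vectors of the kernel lie in the totally bounded image of the unit ball under
  \<open>Q\<close>. Orthonormal vectors are at distance \<open>sqrt 2\<close>, so a ball of radius
  1/2 contains at most one of them, and the number of balls in a cover bounds the
  cardinality.\<close>

lemma maximal_real_orthonormal_kernel:
  fixes M Q :: "'a \<Rightarrow>\<^sub>L 'a"
  assumes Q: "\<And>x. M x = 0 \<Longrightarrow> Q x = x" and comp: "compact_op Q"
  obtains E where "real_orthonormal_kernel M E"
    "\<And>E'. real_orthonormal_kernel M E' \<Longrightarrow> card E' \<le> card E"
proof -
  obtain k where k: "finite k" "closure (blinfun_apply Q ` cball 0 1) \<subseteq> (\<Union>x\<in>k. ball x (1/2))"
    using comp unfolding compact_op_def compact_eq_totally_bounded
    by (meson half_gt_zero_iff zero_less_one)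
  have bound: "card E \<le> card k" if E: "real_orthonormal_kernel M E" for E
  proof -
    have "\<exists>y\<in>k. dist y e < 1/2" if "e \<in> E" for e
    proof -
      have "Q e = e" "norm e \<le> 1" using E that Q unfolding real_orthonormal_kernel_def by auto
      then have "e \<in> blinfun_apply Q ` cball 0 1" by (metis imageI mem_cball_0)
      then have "e \<in> (\<Union>x\<in>k. ball x (1/2))" using k(2) closure_subset by (meson subsetD)
      then show ?thesis by auto
    qed
    then obtain \<phi> where \<phi>: "\<And>e. e \<in> E \<Longrightarrow> \<phi> e \<in> k" "\<And>e. e \<in> E \<Longrightarrow> dist (\<phi> e) e < 1/2" by metis
    have "inj_on \<phi> E"
    proof (rule inj_onI, rule ccontr)
      fix e f assume ef: "e \<in> E" "f \<in> E" "\<phi> e = \<phi> f" "e \<noteq> f"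
      have "dist e f < 1"
        using \<phi>(2)[OF ef(1)] \<phi>(2)[OF ef(2)] ef(3) dist_triangle2[of e f "\<phi> e"]
        by (simp add: dist_commute)
      then have "(norm (e - f))\<^sup>2 < 1\<^sup>2" by (intro power_strict_mono) (auto simp: dist_norm)
      moreover have "(norm (e - f))\<^sup>2 = (norm e)\<^sup>2 + (norm f)\<^sup>2 - 2 * (e \<bullet> f)"
        unfolding power2_norm_eq_inner by (simp add: inner_diff_left inner_diff_right inner_commute)
      ultimately show False using E ef unfolding real_orthonormal_kernel_def by auto
    qed
    moreover have "\<phi> ` E \<subseteq> k" using \<phi>(1) by (rule image_subsetI)
    ultimately show ?thesis using k(1) by (rule card_inj_on_le)
  qed
  have "real_orthonormal_kernel M {}" by (simp add: real_orthonormal_kernel_def)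
  moreover have "\<forall>E. real_orthonormal_kernel M E \<longrightarrow> card E < Suc (card k)" using bound less_Suc_eq_le by blast
  ultimately have "\<exists>E. real_orthonormal_kernel M E
      \<and> (\<forall>E'. real_orthonormal_kernel M E' \<longrightarrow> card E' \<le> card E)"
    by (rule ex_has_greatest_nat[where f=card])
  then show ?thesis using that by blast
qed

text \<open>The kernel of \<open>M\<close> is a finite-dimensional complex space, and any such space
  carries a conjugation; adding one removes the kernel. No index or parity obstructs this, which is
  why a single path component can result.\<close>

lemma injective_perturbation:
  fixes M Q :: "'a \<Rightarrow>\<^sub>L 'a"
  assumes M: "adjoint_pair M M" and Mj: "\<And>x. M (j x) = - j (M x)" and M\<Lambda>: "\<And>x. M (\<Lambda> x) = \<Lambda> (M x)"
    and Q: "\<And>x. M x = 0 \<Longrightarrow> Q x = x" and comp: "compact_op Q"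
  obtains M' :: "'a \<Rightarrow>\<^sub>L 'a" where "adjoint_pair M' M'" "\<And>x. M' (j x) = - j (M' x)" "\<And>x. M' (\<Lambda> x) = \<Lambda> (M' x)"
    "compact_op (M' - M)" "\<And>x. M' x = 0 \<Longrightarrow> x = 0"
proof -
  obtain E where E: "real_orthonormal_kernel M E"
    and max: "\<And>E'. real_orthonormal_kernel M E' \<Longrightarrow> card E' \<le> card E"
    using maximal_real_orthonormal_kernel[OF Q comp] by blast
  have fin: "finite E" and ME: "\<And>e. e \<in> E \<Longrightarrow> M e = 0" and nE: "\<And>e. e \<in> E \<Longrightarrow> norm e = 1"
    and \<Lambda>E: "\<And>e. e \<in> E \<Longrightarrow> \<Lambda> e = e \<or> \<Lambda> e = 0"
    and orth: "\<And>e f. e \<in> E \<Longrightarrow> f \<in> E \<Longrightarrow> e \<noteq> f \<Longrightarrow> e \<bullet> f = 0"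
    and orthj: "\<And>e f. e \<in> E \<Longrightarrow> f \<in> E \<Longrightarrow> e \<bullet> j f = 0"
    using E unfolding real_orthonormal_kernel_def by auto
  \<comment> \<open>A nonzero \<open>v\<close> of this kind could be normalised and added to
    \<open>E\<close>, against maximality.\<close>
  have homog: "v = 0" if Mv: "M v = 0" and \<Lambda>v: "\<Lambda> v = v \<or> \<Lambda> v = 0"
    and ve: "\<And>e. e \<in> E \<Longrightarrow> v \<bullet> e = 0" and vje: "\<And>e. e \<in> E \<Longrightarrow> v \<bullet> j e = 0" for v
  proof (rule ccontr)
    assume "v \<noteq> 0"
    define w where "w = v /\<^sub>R norm v"
    have ww: "norm w = 1" using \<open>v \<noteq> 0\<close> by (simp add: w_def)
    have we: "w \<bullet> e = 0" "w \<bullet> j e = 0" if "e \<in> E" for e using ve vje that by (simp_all add: w_def)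
    have jw: "e \<bullet> j w = 0" if "e \<in> E" for e
      using adjoint_pairD[OF j_adj, of e w] we(2)[OF that] by (simp add: blinfun.bilinear_simps inner_commute)
    have "w \<notin> E" using we(1)[of w] ww by (auto simp: norm_eq_sqrt_inner)
    have "real_orthonormal_kernel M (insert w E)"
      unfolding real_orthonormal_kernel_def
      using fin ME nE \<Lambda>E orth orthj we jw ww Mv \<Lambda>v inner_j_self[of w]
      by (auto simp: w_def blinfun.bilinear_simps inner_commute)
    then have "card (insert w E) \<le> card E" by (rule max)
    then show False using \<open>w \<notin> E\<close> fin by simp
  qed
  \<comment> \<open>The component \<open>\<Lambda> v\<close> is homogeneous and inherits the
    hypotheses, so it vanishes. Then \<open>v\<close> itself is homogeneous.\<close>
  have complete: "v = 0" if Mv: "M v = 0"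
    and ve: "\<And>e. e \<in> E \<Longrightarrow> v \<bullet> e = 0" and vje: "\<And>e. e \<in> E \<Longrightarrow> v \<bullet> j e = 0" for v
  proof -
    have "\<Lambda> v = 0"
    proof (rule homog)
      show "M (\<Lambda> v) = 0" using Mv by (simp add: M\<Lambda>)
      show "\<Lambda> (\<Lambda> v) = \<Lambda> v \<or> \<Lambda> (\<Lambda> v) = 0" by (simp add: \<Lambda>\<Lambda>)
      show "\<Lambda> v \<bullet> e = 0" if "e \<in> E" for e
        using \<Lambda>E[OF that] ve[OF that] by (auto simp: adjoint_pairD[OF \<Lambda>_adj])
      show "\<Lambda> v \<bullet> j e = 0" if "e \<in> E" for e
        using \<Lambda>E[OF that] vje[OF that] by (auto simp: adjoint_pairD[OF \<Lambda>_adj] \<Lambda>j)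
    qed
    then show ?thesis using homog that by blast
  qed
  \<comment> \<open>The conjugation of the complex span of \<open>E\<close> that fixes each
    \<open>e\<close> and negates each \<open>j e\<close>, extended by 0 to the orthogonal
    complement.\<close>
  define J where "J = (\<Sum>e\<in>E. rank_one e - rank_one (j e))"
  have J: "J x = (\<Sum>e\<in>E. (e \<bullet> x) *\<^sub>R e - (j e \<bullet> x) *\<^sub>R j e)" for x
    by (simp add: J_def blinfun.sum_left blinfun.diff_left)
  have J_adj: "adjoint_pair J J" unfolding adjoint_pair_def J
    by (auto simp: inner_sum_left inner_sum_right inner_diff_left inner_diff_right inner_commute mult.commute
        intro!: sum.cong)
  have Jj: "J (j x) = - j (J x)" for x
    unfolding J blinfun.sum_right sum_negf[symmetric]
    using adjoint_pairD[OF j_adj]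
    by (intro sum.cong) (auto simp: blinfun.bilinear_simps jj)
  have J\<Lambda>: "J (\<Lambda> x) = \<Lambda> (J x)" for x
    unfolding J blinfun.sum_right
  proof (rule sum.cong[OF refl])
    fix e assume e: "e \<in> E"
    have "e \<bullet> \<Lambda> x = \<Lambda> e \<bullet> x" "j e \<bullet> \<Lambda> x = j (\<Lambda> e) \<bullet> x"
      using adjoint_pairD[OF \<Lambda>_adj] by (simp_all add: \<Lambda>j[symmetric])
    then show "(e \<bullet> \<Lambda> x) *\<^sub>R e - (j e \<bullet> \<Lambda> x) *\<^sub>R j e = \<Lambda> ((e \<bullet> x) *\<^sub>R e - (j e \<bullet> x) *\<^sub>R j e)"
      using \<Lambda>E[OF e] by (auto simp: blinfun.bilinear_simps \<Lambda>j)
  qed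
  have MJ: "M (J x) = 0" for x
    unfolding J blinfun.sum_right by (intro sum.neutral) (simp add: blinfun.bilinear_simps Mj ME)
  have eJ: "e \<bullet> J x = e \<bullet> x" if e: "e \<in> E" for e x
  proof -
    have "e \<bullet> J x = (\<Sum>f\<in>E. if f = e then e \<bullet> x else 0)"
      unfolding J inner_sum_right
    proof (rule sum.cong[OF refl])
      fix f assume f: "f \<in> E"
      show "e \<bullet> ((f \<bullet> x) *\<^sub>R f - (j f \<bullet> x) *\<^sub>R j f) = (if f = e then e \<bullet> x else 0)"
        using orth[OF e f] orthj[OF e f] nE[OF e] by (auto simp: inner_diff_right norm_eq_1)
    qed
    then show ?thesis using fin e by simp
  qed
  show ?thesis
  proof (rule that[of "M + J"])
    show "adjoint_pair (M + J) (M + J)" by (intro adjoint_pair_add M J_adj)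
    show "(M + J) (j x) = - j ((M + J) x)" for x by (simp add: blinfun.bilinear_simps Mj Jj)
    show "(M + J) (\<Lambda> x) = \<Lambda> ((M + J) x)" for x by (simp add: blinfun.bilinear_simps M\<Lambda> J\<Lambda>)
    show "compact_op (M + J - M)"
      by (simp add: J_def compact_op_sum compact_op_diff compact_op_rank_one)
    fix x assume "(M + J) x = 0"
    then have MJx: "M x = - J x" by (simp add: blinfun.bilinear_simps eq_neg_iff_add_eq_0)
    \<comment> \<open>\<open>M J = 0\<close> and symmetry of \<open>M\<close> make the ranges of
      \<open>M\<close> and \<open>J\<close> orthogonal, so \<open>M x\<close> and \<open>J x\<close>
      cannot cancel unless both vanish.\<close>
    have "J x \<bullet> J x = - (J x \<bullet> M x)" by (simp add: MJx)
    then have Jx: "J x = 0" by (simp add: adjoint_pairD[OF M, symmetric] MJ)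
    show "x = 0"
    proof (rule complete)
      show "M x = 0" using MJx Jx by simp
      fix e assume e: "e \<in> E"
      show "x \<bullet> e = 0" using eJ[OF e, of x] Jx by (simp add: inner_commute)
      have "e \<bullet> j x = 0" using eJ[OF e, of "j x"] Jx by (simp add: Jj blinfun.bilinear_simps)
      then show "x \<bullet> j e = 0"
        using adjoint_pairD[OF j_adj, of e x] by (simp add: blinfun.bilinear_simps inner_commute)
    qed
  qed
qed

text \<open>
  The diagonal part \<open>M\<close> of \<open>T\<close> with respect to \<open>\<Lambda>\<close> differs from \<open>T\<close> by a compact operator; \<open>T'\<close> is the
  sign of an injective compact perturbation of \<open>M\<close>.
\<close>

lemma commuting_compact_perturbation:
  assumes T: "T \<in> conj_ops"
  obtains T' :: "'a \<Rightarrow>\<^sub>L 'a" where "T' \<in> conj_ops" "\<And>x. T' (\<Lambda> x) = \<Lambda> (T' x)" "compact_op (T - T')"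
proof -
  note T_adj = conj_opsD(1)[OF T] and TT = conj_opsD(2)[OF T] and Tj = conj_opsD(3)[OF T]
  define K where "K = (\<Lambda> o\<^sub>L T) - (T o\<^sub>L \<Lambda>)"
  have K: "compact_op K" using conj_opsD(4)[OF T] by (simp add: local_op_def K_def)
  \<comment> \<open>The subtracted term equals
    \<open>\<Lambda> T (1 - \<Lambda>) + (1 - \<Lambda>) T \<Lambda>\<close>, the off-diagonal part
    of \<open>T\<close>, written so that its compactness follows from that of
    \<open>K\<close>.\<close>
  define M where "M = T - (K o\<^sub>L (id_blinfun - 2 *\<^sub>R \<Lambda>))"
  have M: "M x = T x - \<Lambda> (T x) - T (\<Lambda> x) + 2 *\<^sub>R \<Lambda> (T (\<Lambda> x))" for x
    by (simp add: M_def K_def blinfun.bilinear_simps \<Lambda>\<Lambda> scaleR_2 algebra_simps)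
  have TM: "compact_op (T - M)" using K by (simp add: M_def compact_op_compose_right)
  have M_adj: "adjoint_pair M M" unfolding adjoint_pair_def M
    by (simp add: inner_left_distrib inner_right_distrib inner_diff_left inner_diff_right
        adjoint_pairD[OF T_adj] adjoint_pairD[OF \<Lambda>_adj])
  have Mj: "M (j x) = - j (M x)" for x
    by (simp add: M blinfun.bilinear_simps Tj \<Lambda>j algebra_simps)
  have M\<Lambda>: "M (\<Lambda> x) = \<Lambda> (M x)" for x
    by (simp add: M blinfun.bilinear_simps \<Lambda>\<Lambda> scaleR_2)
  obtain Q where Q: "adjoint_pair Q Q" "\<And>x. M (Q x) = 0" "\<And>x. M x = 0 \<Longrightarrow> Q x = x"
    using kernel_projection_exists[of M] by blast
  \<comment> \<open>On the kernel of \<open>M\<close> the operators \<open>T\<close> and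
    \<open>T - M\<close> agree, and \<open>T\<close> is an involution; thus the kernel projection
    factors through a compact operator.\<close>
  have "Q = T o\<^sub>L ((T - M) o\<^sub>L Q)"
    by (intro blinfun_eqI) (simp add: blinfun.bilinear_simps Q TT)
  then have "compact_op Q" using TM by (metis compact_op_compose_left compact_op_compose_right)
  then obtain N where N: "adjoint_pair N N" "\<And>x. N (j x) = - j (N x)" "\<And>x. N (\<Lambda> x) = \<Lambda> (N x)"
    "compact_op (N - M)" "\<And>x. N x = 0 \<Longrightarrow> x = 0"
    using injective_perturbation[OF M_adj Mj M\<Lambda> Q(3)] by blast
  have NT: "compact_op (N - T)" using compact_op_diff[OF N(4) TM] by simp
  obtain R \<sigma> where R: "adjoint_pair R R" "\<And>x. 0 \<le> R x \<bullet> x" "\<And>x. R (R x) = N (N x)"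
    and \<sigma>: "adjoint_pair \<sigma> \<sigma>" "\<And>x. \<sigma> (\<sigma> x) = x" "\<And>x. \<sigma> (R x) = N x" "\<And>x. R (\<sigma> x) = N x"
    and commR: "\<And>(B::'a \<Rightarrow>\<^sub>L 'a) x. (\<And>x. B (N (N x)) = N (N (B x))) \<Longrightarrow> B (R x) = R (B x)"
    and comm\<sigma>: "\<And>(B::'a \<Rightarrow>\<^sub>L 'a) B' x. adjoint_pair B B' \<Longrightarrow> (\<And>x. B (N x) = N (B x)) \<Longrightarrow> (\<And>x. B' (N x) = N (B' x)) \<Longrightarrow>
      \<sigma> (B x) = B (\<sigma> x)"
    using sign_exists[OF N(1)] by blast
  have \<sigma>\<Lambda>: "\<sigma> (\<Lambda> x) = \<Lambda> (\<sigma> x)" for x by (rule comm\<sigma>[OF \<Lambda>_adj]) (simp_all add: N)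
  \<comment> \<open>Positivity of \<open>R\<close> bounds \<open>R + 1\<close> below, so it can be
    cancelled from \<open>R\<^sup>2 - 1\<close>, the product of \<open>R + 1\<close> and
    \<open>R - 1\<close>.\<close>
  have R1: "1 * norm x \<le> norm ((R + id_blinfun) x)" for x
  proof -
    have "norm x * norm x \<le> (R + id_blinfun) x \<bullet> x"
      using R(2)[of x] by (simp add: blinfun.bilinear_simps inner_left_distrib
          power2_norm_eq_inner[symmetric] power2_eq_square)
    also have "\<dots> \<le> norm ((R + id_blinfun) x) * norm x" by (rule norm_cauchy_schwarz)
    finally show ?thesis by (cases "x = 0") auto
  qed
  obtain H :: "'a \<Rightarrow>\<^sub>L 'a" where H: "\<And>x. H ((R + id_blinfun) x) = x"
  proof (rule bounded_below_inverse[OF adjoint_pair_add[OF R(1) adjoint_pair_id] _ R1])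
    show "x = 0" if "(R + id_blinfun) x = 0" for x using R1[of x] that by simp
  qed auto
  \<comment> \<open>Here \<open>R\<^sup>2 - 1 = N\<^sup>2 - T\<^sup>2 = N (N - T) + (N - T)
    T\<close>, which is compact.\<close>
  have "R - id_blinfun = H o\<^sub>L ((N o\<^sub>L (N - T)) + ((N - T) o\<^sub>L T))"
  proof (rule blinfun_eqI)
    fix x
    have "N (N x - T x) + (N (T x) - T (T x)) = (R + id_blinfun) (R x - x)"
      by (simp add: blinfun.bilinear_simps TT R(3))
    then show "(R - id_blinfun) x = (H o\<^sub>L ((N o\<^sub>L (N - T)) + ((N - T) o\<^sub>L T))) x"
      using H[of "R x - x"] by (simp add: blinfun.add_left blinfun.diff_left)
  qed
  then have R1c: "compact_op (R - id_blinfun)"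
    by (metis NT compact_op_add compact_op_compose_left compact_op_compose_right)
  have "T - \<sigma> = (\<sigma> o\<^sub>L (R - id_blinfun)) - (N - T)"
    by (intro blinfun_eqI) (simp add: blinfun.bilinear_simps \<sigma>)
  then have T\<sigma>: "compact_op (T - \<sigma>)"
    by (metis NT R1c compact_op_diff compact_op_compose_left)
  have "\<sigma> (j x) = - j (\<sigma> x)" for x
  proof (rule sign_anticommute[OF R(1) \<sigma>(1,3) _ N(2) j_adj])
    show "j (R x) = R (j x)" for x by (rule commR) (simp add: N blinfun.bilinear_simps)
    show "x = 0" if "R x = 0" for x
    proof -
      have "N (N x) = 0" using R(3)[of x] that by simp
      then show ?thesis using N(5) by blast
    qed
  qed
  then have "\<sigma> \<in> conj_ops"
    by (intro conj_opsI \<sigma> local_op_commute) (simp_all add: \<sigma>\<Lambda>)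
  then show ?thesis using \<sigma>\<Lambda> T\<sigma> by (rule that)
qed

section \<open>The three paths that lead from \<open>T\<close> to \<open>C\<close>\<close>

lemma conj_ops_unitary_conjugate:
  fixes W W' T :: "'a \<Rightarrow>\<^sub>L 'a"
  assumes T: "T \<in> conj_ops" and W: "adjoint_pair W W'" "\<And>x. W (W' x) = x" "\<And>x. W' (W x) = x"
    and j: "\<And>x. W (j x) = j (W x)" "\<And>x. W' (j x) = j (W' x)"
    and \<Lambda>: "\<And>x. \<Lambda> (W x) = W (\<Lambda> x)" "\<And>x. \<Lambda> (W' x) = W' (\<Lambda> x)"
  shows "W' o\<^sub>L (T o\<^sub>L W) \<in> conj_ops"
proof (rule conj_opsI)
  show "adjoint_pair (W' o\<^sub>L (T o\<^sub>L W)) (W' o\<^sub>L (T o\<^sub>L W))"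
    unfolding adjoint_pair_def
    by (simp add: adjoint_pairD[OF W(1)] adjoint_pairD[OF conj_opsD(1)[OF T]]
        adjoint_pairD[OF W(1)[unfolded adjoint_pair_commute[of W]]])
  show "local_op (W' o\<^sub>L (T o\<^sub>L W))"
    by (intro local_op_compose conj_opsD(4)[OF T] local_op_commute \<Lambda>)
qed (simp_all add: W conj_opsD(2,3)[OF T] j blinfun.bilinear_simps)

text \<open>
  Rotating \<open>T\<close> by \<open>exp (\<theta> j P)\<close> up to \<open>\<theta> = \<pi>/2\<close>, where \<open>P\<close> is the negative spectral projection
  of the anticommutator \<open>Z\<close> of \<open>C\<close> with a compact perturbation \<open>T'\<close> of \<open>T\<close>, replaces \<open>T'\<close> by \<open>T' \<sigma>\<close>,
  and makes the anticommutator \<open>|Z|\<close>.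
\<close>

lemma path_to_positive_anticommutator:
  fixes T C :: "'a \<Rightarrow>\<^sub>L 'a"
  assumes T: "T \<in> conj_ops" and C: "C \<in> conj_ops" and C\<Lambda>: "\<And>x. C (\<Lambda> x) = \<Lambda> (C x)"
  obtains T1 B :: "'a \<Rightarrow>\<^sub>L 'a" where "T1 \<in> conj_ops" "path_component conj_ops T T1"
    "adjoint_pair B B" "\<And>x. norm x \<le> norm (B x)" "compact_op (T1 + C - B)"
proof -
  note C_adj = conj_opsD(1)[OF C] and CC = conj_opsD(2)[OF C] and Cj = conj_opsD(3)[OF C]
  obtain T' :: "'a \<Rightarrow>\<^sub>L 'a" where T': "T' \<in> conj_ops" "\<And>x. T' (\<Lambda> x) = \<Lambda> (T' x)" "compact_op (T - T')"
    using commuting_compact_perturbation[OF T] by blast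
  note T'_adj = conj_opsD(1)[OF T'(1)] and T'T' = conj_opsD(2)[OF T'(1)] and T'j = conj_opsD(3)[OF T'(1)]
  \<comment> \<open>The anticommutator of two involutions commutes with each of them. It also
    commutes with \<open>j\<close>, with which both anticommute, and with \<Lambda>; its sign
    inherits all this.\<close>
  define Z where "Z = (T' o\<^sub>L C) + (C o\<^sub>L T')"
  have Z: "Z x = T' (C x) + C (T' x)" for x by (simp add: Z_def blinfun.bilinear_simps)
  have Z_adj: "adjoint_pair Z Z" unfolding adjoint_pair_def Z
    by (simp add: inner_left_distrib inner_right_distrib adjoint_pairD[OF T'_adj] adjoint_pairD[OF C_adj])
  obtain R \<sigma> :: "'a \<Rightarrow>\<^sub>L 'a" where "adjoint_pair R R" and R: "\<And>x. 0 \<le> R x \<bullet> x" and "\<And>x. R (R x) = Z (Z x)"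
    and \<sigma>: "adjoint_pair \<sigma> \<sigma>" "\<And>x. \<sigma> (\<sigma> x) = x" and "\<And>x. \<sigma> (R x) = Z x" and R\<sigma>: "\<And>x. R (\<sigma> x) = Z x"
    and "\<And>(B::'a \<Rightarrow>\<^sub>L 'a) x. (\<And>x. B (Z (Z x)) = Z (Z (B x))) \<Longrightarrow> B (R x) = R (B x)"
    and comm: "\<And>(B::'a \<Rightarrow>\<^sub>L 'a) B' x. adjoint_pair B B' \<Longrightarrow> (\<And>x. B (Z x) = Z (B x)) \<Longrightarrow> (\<And>x. B' (Z x) = Z (B' x)) \<Longrightarrow>
      \<sigma> (B x) = B (\<sigma> x)"
    using sign_exists[OF Z_adj] by blast
  have \<sigma>C: "\<sigma> (C x) = C (\<sigma> x)" for x by (rule comm[OF C_adj]) (simp_all add: Z blinfun.bilinear_simps CC)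
  have \<sigma>T': "\<sigma> (T' x) = T' (\<sigma> x)" for x
    by (rule comm[OF T'_adj]) (simp_all add: Z blinfun.bilinear_simps T'T')
  have \<sigma>j: "\<sigma> (j x) = j (\<sigma> x)" for x
    by (rule comm[OF j_adj]) (simp_all add: Z blinfun.bilinear_simps T'j Cj)
  have \<sigma>\<Lambda>: "\<sigma> (\<Lambda> x) = \<Lambda> (\<sigma> x)" for x
    by (rule comm[OF \<Lambda>_adj]) (simp_all add: Z blinfun.bilinear_simps T' C\<Lambda>)
  define P where "P = (1/2) *\<^sub>R (id_blinfun - \<sigma>)"
  have P_adj: "adjoint_pair P P" unfolding P_def
    by (intro adjoint_pair_scaleR adjoint_pair_diff adjoint_pair_id \<sigma>)
  have P: "P x = (1/2) *\<^sub>R (x - \<sigma> x)" for x by (simp add: P_def blinfun.bilinear_simps)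
  have PP: "P (P x) = P x" for x
  proof -
    have "\<sigma> (P x) = - P x" by (simp add: P blinfun.bilinear_simps \<sigma> algebra_simps)
    then show ?thesis unfolding P[of "P x"] by simp
  qed
  have Pj: "P (j x) = j (P x)" for x by (simp add: P blinfun.bilinear_simps \<sigma>j)
  have P\<Lambda>: "\<Lambda> (P x) = P (\<Lambda> x)" for x by (simp add: P blinfun.bilinear_simps \<sigma>\<Lambda>)
  have PT': "T' (P x) = P (T' x)" for x by (simp add: P blinfun.bilinear_simps \<sigma>T')
  \<comment> \<open>This is \<open>exp (\<theta> j P)\<close>, expanded with the fact that
    \<open>j P\<close> squares to \<open>- P\<close>.\<close>
  define S where "S \<theta> = id_blinfun - P + cos \<theta> *\<^sub>R P + sin \<theta> *\<^sub>R (j o\<^sub>L P)" for \<theta>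
  have S: "S \<theta> x = x - P x + cos \<theta> *\<^sub>R P x + sin \<theta> *\<^sub>R j (P x)" for \<theta> x
    by (simp add: S_def blinfun.bilinear_simps)
  have S_adj: "adjoint_pair (S \<theta>) (S (- \<theta>))" for \<theta> unfolding adjoint_pair_def S
    by (simp add: inner_left_distrib inner_right_distrib inner_diff_left inner_diff_right
        adjoint_pairD[OF P_adj] adjoint_pairD[OF j_adj] blinfun.bilinear_simps Pj)
  have cs: "(cos \<theta> * cos \<theta>) *\<^sub>R y + (sin \<theta> * sin \<theta>) *\<^sub>R y = y" for \<theta> and y :: 'a
    by (simp flip: scaleR_add_left power2_eq_square)
  have SS: "S (- \<theta>) (S \<theta> x) = x" for \<theta> x
    using cs[of \<theta> "P x"]
    by (simp add: S blinfun.bilinear_simps PP Pj jj algebra_simps)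
  have SS': "S \<theta> (S (- \<theta>) x) = x" for \<theta> x using SS[of "- \<theta>" x] by simp
  have Sj: "S \<theta> (j x) = j (S \<theta> x)" for \<theta> x by (simp add: S blinfun.bilinear_simps Pj)
  have S\<Lambda>: "\<Lambda> (S \<theta> x) = S \<theta> (\<Lambda> x)" for \<theta> x by (simp add: S blinfun.bilinear_simps P\<Lambda> \<Lambda>j)
  \<comment> \<open>Since \<open>T'\<close> anticommutes with \<open>j P\<close>, this conjugation
    turns \<open>T'\<close> into \<open>T' exp (2 \<theta> j P)\<close>. The angle doubles, so
    \<open>\<theta> = pi/2\<close> already yields \<open>T' (1 - 2 P) = T' \<sigma>\<close>.\<close>
  define g where "g t = S (- (t * (pi/2))) o\<^sub>L (T o\<^sub>L S (t * (pi/2)))" for t :: real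
  have g: "g t \<in> conj_ops" for t unfolding g_def
    by (rule conj_ops_unitary_conjugate[OF T S_adj SS' SS Sj Sj S\<Lambda> S\<Lambda>])
  have "continuous_on {0..1} g" unfolding g_def S_def by (intro continuous_intros)
  moreover have "g 0 = T" by (intro blinfun_eqI) (simp add: g_def S)
  ultimately have pc: "path_component conj_ops T (g 1)"
    unfolding path_component_def path_def path_image_def pathstart_def pathfinish_def using g by blast
  \<comment> \<open>The value of \<open>g 1 + C\<close> with \<open>T'\<close> in place of
    \<open>T\<close>. Its square is 2 plus the anticommutator of \<open>T' \<sigma>\<close> and
    \<open>C\<close>, which is \<open>Z \<sigma> = R\<close>; this gives the lower bound.\<close>
  define B where "B = (T' o\<^sub>L \<sigma>) + C"
  have B: "B x = T' (\<sigma> x) + C x" for x by (simp add: B_def blinfun.bilinear_simps)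
  show ?thesis
  proof (rule that[OF g pc])
    show "adjoint_pair B B" unfolding adjoint_pair_def B
      by (simp add: inner_left_distrib inner_right_distrib adjoint_pairD[OF T'_adj] adjoint_pairD[OF C_adj]
          adjoint_pairD[OF \<sigma>(1)] \<sigma>T')
    fix x
    have "T' (\<sigma> x) \<bullet> T' (\<sigma> x) = x \<bullet> x" "C x \<bullet> C x = x \<bullet> x"
      by (simp_all add: adjoint_pairD[OF T'_adj] adjoint_pairD[OF C_adj] adjoint_pairD[OF \<sigma>(1)] T'T' CC \<sigma>)
    moreover have "2 * (T' (\<sigma> x) \<bullet> C x) = R x \<bullet> x"
    proof -
      have "R x = Z (\<sigma> x)" using R\<sigma>[of "\<sigma> x"] by (simp add: \<sigma>)
      then have "R x \<bullet> x = T' (C (\<sigma> x)) \<bullet> x + C (T' (\<sigma> x)) \<bullet> x" by (simp add: Z inner_left_distrib)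
      also have "C (T' (\<sigma> x)) \<bullet> x = T' (\<sigma> x) \<bullet> C x" by (rule adjoint_pairD[OF C_adj])
      also have "T' (C (\<sigma> x)) \<bullet> x = C x \<bullet> T' (\<sigma> x)"
        by (simp add: adjoint_pairD[OF T'_adj] adjoint_pairD[OF \<sigma>(1)] \<sigma>T' flip: \<sigma>C)
      finally show ?thesis by (simp add: inner_commute)
    qed
    ultimately have "(norm (B x))\<^sup>2 = 2 * (norm x)\<^sup>2 + R x \<bullet> x"
      unfolding power2_norm_eq_inner B
      by (simp add: inner_left_distrib inner_right_distrib inner_commute)
    then have "(norm x)\<^sup>2 \<le> (norm (B x))\<^sup>2" using R[of x] by (smt (verit) zero_le_power2)
    then show "norm x \<le> norm (B x)" by (rule power2_le_imp_le) simp
  next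
    have "S (- (pi/2)) (T' (S (pi/2) x)) = T' (\<sigma> x)" for x
    proof -
      have "S (- (pi/2)) (T' (S (pi/2) x)) = T' (x - 2 *\<^sub>R P x)"
        by (simp add: S blinfun.bilinear_simps PP Pj jj T'j PT' algebra_simps scaleR_2)
      also have "x - 2 *\<^sub>R P x = \<sigma> x" by (simp add: P)
      finally show ?thesis .
    qed
    then have "g 1 + C - B = S (- (pi/2)) o\<^sub>L ((T - T') o\<^sub>L S (pi/2))"
      by (intro blinfun_eqI) (simp add: g_def B blinfun.bilinear_simps)
    then show "compact_op (g 1 + C - B)"
      using T'(3) by (simp add: compact_op_compose_left compact_op_compose_right)
  qed
qed

text \<open>The kernel of \<open>T + C\<close> reduces \<open>T\<close>, \<open>C\<close> and
  \<open>j\<close>, and there \<open>T = - C\<close>. A half turn by \<open>j\<close> on it carries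
  \<open>T\<close> to \<open>C\<close>, so \<open>T + C\<close> becomes \<open>2 C\<close> on the
  kernel and is unchanged on the complement. Injectivity then gives a lower bound because
  \<open>T' + C - B\<close> stays compact.\<close>

lemma path_to_bounded_below:
  fixes T C B :: "'a \<Rightarrow>\<^sub>L 'a"
  assumes T: "T \<in> conj_ops" and C: "C \<in> conj_ops" and B: "adjoint_pair B B" "\<And>x. norm x \<le> norm (B x)"
    and comp: "compact_op (T + C - B)"
  obtains T' :: "'a \<Rightarrow>\<^sub>L 'a" and c where "T' \<in> conj_ops" "path_component conj_ops T T'"
    "c > 0" "\<And>x. c * norm x \<le> norm ((T' + C) x)"
proof -
  note T_adj = conj_opsD(1)[OF T] and TT = conj_opsD(2)[OF T] and Tj = conj_opsD(3)[OF T]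
  note C_adj = conj_opsD(1)[OF C] and CC = conj_opsD(2)[OF C] and Cj = conj_opsD(3)[OF C]
  obtain H :: "'a \<Rightarrow>\<^sub>L 'a" where H: "\<And>x. H (B x) = x"
  proof (rule bounded_below_inverse[OF B(1), of 1])
    show "x = 0" if "B x = 0" for x using B(2)[of x] that by simp
  qed (use B(2) in auto)
  obtain Q where Q: "adjoint_pair Q Q" "\<And>x. (T + C) (Q x) = 0" "\<And>x. (T + C) x = 0 \<Longrightarrow> Q x = x"
    using kernel_projection_exists[of "T + C"] by blast
  have TCQ: "T (Q x) = - C (Q x)" for x
    using Q(2)[of x] by (simp add: blinfun.bilinear_simps add_eq_0_iff2)
  have QQ: "Q (Q x) = Q x" for x using Q(3)[OF Q(2)] .
  have ker: "T x = - C x" if "(T + C) x = 0" for x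
    using that by (simp add: blinfun.bilinear_simps add_eq_0_iff2)
  have kerT: "(T + C) (T x) = 0" if "(T + C) x = 0" for x
    using ker[OF that] TT[of x] by (simp add: blinfun.bilinear_simps CC)
  have kerC: "(T + C) (C x) = 0" if "(T + C) x = 0" for x
    using kerT[OF that] ker[OF that] by (simp add: blinfun.minus_right)
  have kerj: "(T + C) (j x) = 0" if "(T + C) x = 0" for x
    using ker[OF that] by (simp add: blinfun.bilinear_simps Tj Cj)
  have QT: "Q (T x) = T (Q x)" for x by (rule kernel_projection_commute[OF Q T_adj kerT kerT])
  have QC: "Q (C x) = C (Q x)" for x by (rule kernel_projection_commute[OF Q C_adj kerC kerC])
  have Qj: "Q (j x) = j (Q x)" for x
    by (rule kernel_projection_commute[OF Q j_adj kerj])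
      (simp_all only: blinfun.minus_left blinfun.minus_right kerj neg_0_equal_iff_equal simp_thms minus_zero)
  \<comment> \<open>On the kernel of \<open>T + C\<close> the compact operator
    \<open>T + C - B\<close> equals \<open>- B\<close>, which \<open>H\<close> undoes.\<close>
  have "Q = - (H o\<^sub>L ((T + C - B) o\<^sub>L Q))"
    by (intro blinfun_eqI) (simp add: blinfun.bilinear_simps TCQ H)
  then have Qc: "compact_op Q"
    using comp by (metis compact_op_compose_left compact_op_compose_right compact_op_minus)
  \<comment> \<open>This is \<open>T exp (t pi j Q)\<close>. It differs from \<open>T\<close> by a
    compact operator, hence stays local.\<close>
  define g where "g t = T + (T o\<^sub>L ((cos (t * pi) - 1) *\<^sub>R Q + sin (t * pi) *\<^sub>R (j o\<^sub>L Q)))" for t :: real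
  have g: "g t x = T x + (cos (t * pi) - 1) *\<^sub>R T (Q x) + sin (t * pi) *\<^sub>R T (j (Q x))" for t x
    by (simp add: g_def blinfun.bilinear_simps)
  have mem: "g t \<in> conj_ops" for t
  proof (rule conj_opsI)
    show "adjoint_pair (g t) (g t)" unfolding adjoint_pair_def g
      by (simp add: inner_left_distrib inner_right_distrib inner_diff_left inner_diff_right adjoint_pairD[OF T_adj] adjoint_pairD[OF Q(1)]
          adjoint_pairD[OF j_adj] QT Qj Tj blinfun.bilinear_simps)
    show "g t (j x) = - j (g t x)" for x by (simp add: g Qj Tj blinfun.bilinear_simps)
    show "local_op (g t)" unfolding g_def
      by (intro local_op_add conj_opsD(4)[OF T] local_op_compact compact_op_compose_left compact_op_add
          compact_op_scaleR Qc)
    fix x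
    have cs: "(cos (t * pi) * cos (t * pi)) *\<^sub>R Q x + (sin (t * pi) * sin (t * pi)) *\<^sub>R Q x = Q x"
      by (simp flip: scaleR_add_left power2_eq_square)
    then show "g t (g t x) = x"
      by (simp add: g blinfun.bilinear_simps Tj QT TT Qj QQ jj algebra_simps)
  qed
  have "continuous_on {0..1} g" unfolding g_def by (intro continuous_intros)
  moreover have "g 0 = T" by (intro blinfun_eqI) (simp add: g)
  ultimately have pc: "path_component conj_ops T (g 1)"
    unfolding path_component_def path_def path_image_def pathstart_def pathfinish_def using mem by blast
  have g1: "g 1 x = T x - 2 *\<^sub>R T (Q x)" for x by (simp add: g)
  have eq: "g 1 + C - B = (T + C - B) - 2 *\<^sub>R (T o\<^sub>L Q)"
    by (intro blinfun_eqI) (simp add: blinfun.bilinear_simps g1)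
  have gc: "compact_op (g 1 + C - B)"
    unfolding eq by (intro compact_op_diff comp compact_op_scaleR compact_op_compose_left Qc)
  have inj: "x = 0" if "(g 1 + C) x = 0" for x
  proof -
    have x0: "T x - 2 *\<^sub>R T (Q x) + C x = 0" using that by (simp add: blinfun.bilinear_simps g1)
    have "C (Q x) + C (Q x) = 0"
      using arg_cong[OF x0, of Q] by (simp add: blinfun.bilinear_simps QT QC QQ TCQ scaleR_2)
    then have "C (Q x) = 0" by (metis scaleR_2 scaleR_eq_0_iff zero_neq_numeral)
    then have Qx: "Q x = 0" using CC[of "Q x"] by simp
    then have "Q x = x" using x0 by (intro Q(3)) (simp add: blinfun.bilinear_simps)
    then show ?thesis using Qx by simp
  qed
  show ?thesis
    by (rule bounded_below_if_injective[OF gc H]) (fact inj, rule that[OF mem pc])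
qed

text \<open>
  With the Cayley transform \<open>K\<close> of \<open>T\<close> relative to \<open>C\<close>, the conjugates of \<open>C\<close> by \<open>1 + t K\<close>
  interpolate between \<open>C\<close> and \<open>T\<close>; they are symmetric because \<open>(1 - t K) (1 + t K)\<close> commutes with \<open>C\<close>.
\<close>

lemma Cayley_path:
  fixes T C :: "'a \<Rightarrow>\<^sub>L 'a"
  assumes T: "T \<in> conj_ops" and C: "C \<in> conj_ops"
    and c: "c > 0" "\<And>x. c * norm x \<le> norm ((T + C) x)"
  shows "path_component conj_ops C T"
proof -
  note T_adj = conj_opsD(1)[OF T] and TT = conj_opsD(2)[OF T] and Tj = conj_opsD(3)[OF T]
  note C_adj = conj_opsD(1)[OF C] and CC = conj_opsD(2)[OF C] and Cj = conj_opsD(3)[OF C]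
  have TC_adj: "adjoint_pair (T + C) (T + C)" by (intro adjoint_pair_add T_adj C_adj)
  obtain G :: "'a \<Rightarrow>\<^sub>L 'a" where G: "\<And>x. (T + C) (G x) = x" "\<And>x. G ((T + C) x) = x"
  proof (rule bounded_below_inverse[OF TC_adj c])
    show "x = 0" if "(T + C) x = 0" for x
    proof -
      have "c * norm x \<le> 0" using c(2)[of x] that by simp
      then show ?thesis using c(1) by (simp add: mult_le_0_iff)
    qed
  qed auto
  have TG': "T (G x) = x - C (G x)" for x using G(1)[of x] by (simp add: blinfun.bilinear_simps algebra_simps)
  \<comment> \<open>It amounts to \<open>T (T + C) = (T + C) C\<close>, both sides being
    \<open>1 + T C\<close>, multiplied by the inverse on either side; \<open>GC\<close> is the same
    with \<open>T\<close> and \<open>C\<close> exchanged.\<close>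
  have GT: "G (T x) = C (G x)" for x
  proof -
    have "T (C (G x)) = T x - G x"
      using arg_cong[OF TG', of T x] by (simp add: blinfun.bilinear_simps TT algebra_simps)
    then have "(T + C) (C (G x)) = T x" by (simp add: blinfun.bilinear_simps CC)
    then show ?thesis using G(2) by metis
  qed
  have GC: "G (C x) = T (G x)" for x
  proof -
    have "(T + C) (T (G x)) = C x"
      using arg_cong[OF TG', of C x] by (simp add: blinfun.bilinear_simps TT CC)
    then show ?thesis using G(2) by metis
  qed
  have Gj: "G (j x) = - j (G x)" for x
  proof -
    have "(T + C) (- j (G x)) = j ((T + C) (G x))" by (simp add: blinfun.bilinear_simps Tj Cj)
    then show ?thesis using G by metis
  qed
  have G_adj: "adjoint_pair G G" unfolding adjoint_pair_def
    using adjoint_pairD[OF TC_adj] G by metis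
  have G_local: "local_op G"
    by (rule local_op_inverse[OF local_op_add[OF conj_opsD(4)[OF T] conj_opsD(4)[OF C]] G])
  define K where "K = (T - C) o\<^sub>L G"
  have K: "K x = T (G x) - C (G x)" for x by (simp add: K_def blinfun.bilinear_simps)
  have K_adj: "adjoint_pair K (- K)" unfolding adjoint_pair_def
    by (simp add: K blinfun.bilinear_simps inner_diff_left inner_diff_right
        adjoint_pairD[OF T_adj] adjoint_pairD[OF C_adj] adjoint_pairD[OF G_adj] GT GC)
  have KC: "C (K x) = - K (C x)" for x by (simp add: K blinfun.bilinear_simps GC CC TT)
  have Kj: "K (j x) = j (K x)" for x by (simp add: K blinfun.bilinear_simps Gj Tj Cj)
  have K_local: "local_op K" unfolding K_def
    by (intro local_op_compose local_op_diff G_local conj_opsD(4)[OF T] conj_opsD(4)[OF C])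
  define N where "N t = id_blinfun + t *\<^sub>R K" for t
  have N: "N t x = x + t *\<^sub>R K x" for t x by (simp add: N_def blinfun.bilinear_simps)
  have N_adj: "adjoint_pair (N t) (N (- t))" for t
    using adjoint_pair_add[OF adjoint_pair_id adjoint_pair_scaleR[OF K_adj, of t]] by (simp add: N_def)
  have NC: "C (N t x) = N (- t) (C x)" for t x by (simp add: N blinfun.bilinear_simps KC)
  have N_commute: "N s (N t x) = N t (N s x)" for s t x by (simp add: N blinfun.bilinear_simps algebra_simps)
  \<comment> \<open>\<open>K\<close> is skew-symmetric, so the cross term vanishes and
    \<open>1 + t K\<close> is invertible for every real \<open>t\<close>, with an inverse of norm at
    most 1.\<close>
  have N_below: "1 * norm x \<le> norm (N t x)" for t x
  proof -
    have "K x \<bullet> x = 0" using adjoint_pairD[OF K_adj, of x x] by (simp add: blinfun.minus_left inner_commute)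
    then have "(norm (N t x))\<^sup>2 = (norm x)\<^sup>2 + t\<^sup>2 * (norm (K x))\<^sup>2"
      unfolding power2_norm_eq_inner N
      by (simp add: inner_left_distrib inner_right_distrib inner_commute power2_eq_square)
    then have "(norm x)\<^sup>2 \<le> (norm (N t x))\<^sup>2" by simp
    then show ?thesis using power2_le_imp_le by fastforce
  qed
  have "\<exists>N'::'a \<Rightarrow>\<^sub>L 'a. (\<forall>x. N t (N' x) = x) \<and> (\<forall>x. N' (N t x) = x) \<and> (\<forall>x. norm (N' x) \<le> norm x)" for t
  proof (rule bounded_below_inverse[OF N_adj _ N_below])
    show "x = 0" if "N (- t) x = 0" for x using N_below[of x "- t"] that by simp
  qed auto
  then obtain N' :: "real \<Rightarrow> 'a \<Rightarrow>\<^sub>L 'a" where NN': "\<And>t x. N t (N' t x) = x"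
    and N'N: "\<And>t x. N' t (N t x) = x" and N'_le: "\<And>t x. norm (N' t x) \<le> norm x" by metis
  have N'_adj: "adjoint_pair (N' t) (N' (- t))" for t unfolding adjoint_pair_def
    using adjoint_pairD[OF N_adj, of t] NN' by metis
  have N'j: "N' t (j x) = j (N' t x)" for t x
  proof -
    have "N t (j (N' t x)) = j (N t (N' t x))" by (simp add: N blinfun.bilinear_simps Kj)
    then show ?thesis by (metis NN' N'N)
  qed
  have N_local: "local_op (N t)" for t unfolding N_def
    by (intro local_op_add local_op_scaleR K_local local_op_commute) simp
  have N'_local: "local_op (N' t)" for t by (rule local_op_inverse[OF N_local NN' N'N])
  \<comment> \<open>The resolvent identity, with both inverses contractions.\<close>
  have N'_lip: "dist (N' s) (N' t) \<le> norm K * dist s t" for s t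
  proof -
    have "N' s - N' t = N' s o\<^sub>L (((t - s) *\<^sub>R K) o\<^sub>L N' t)"
    proof (rule blinfun_eqI)
      fix x
      have "(t - s) *\<^sub>R K (N' t x) = N t (N' t x) - N s (N' t x)" by (simp add: N algebra_simps)
      then show "(N' s - N' t) x = (N' s o\<^sub>L (((t - s) *\<^sub>R K) o\<^sub>L N' t)) x"
        by (simp add: blinfun.bilinear_simps NN' N'N)
    qed
    moreover have "norm (N' s o\<^sub>L (((t - s) *\<^sub>R K) o\<^sub>L N' t)) \<le> norm K * dist s t"
    proof (rule norm_blinfun_bound)
      fix x
      have "norm (N' s ((t - s) *\<^sub>R K (N' t x))) \<le> norm ((t - s) *\<^sub>R K (N' t x))" by (rule N'_le)
      also have "\<dots> = dist s t * norm (K (N' t x))" by (simp add: dist_real_def abs_minus_commute)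
      also have "\<dots> \<le> dist s t * (norm K * norm x)"
        by (intro mult_left_mono order_trans[OF norm_blinfun] mult_left_mono N'_le) auto
      finally show "norm ((N' s o\<^sub>L (((t - s) *\<^sub>R K) o\<^sub>L N' t)) x) \<le> norm K * dist s t * norm x"
        by (simp add: blinfun.bilinear_simps mult_ac)
    qed simp
    ultimately show ?thesis by (simp add: dist_norm)
  qed
  have N'_cont: "continuous_on {0..1} N'"
    by (rule lipschitz_on_continuous_on[of "norm K"]) (auto simp: lipschitz_on_def N'_lip)
  define g where "g t = N t o\<^sub>L (C o\<^sub>L N' t)" for t
  have "continuous_on {0..1} g" unfolding g_def N_def by (intro continuous_intros N'_cont)
  moreover have "g t \<in> conj_ops" for t
  proof (rule conj_opsI)
    have sym: "g t x = N' (- t) (C (N (- t) x))" for x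
    proof -
      have "N (- t) (g t x) = N t (N (- t) (C (N' t x)))" by (simp add: g_def N_commute)
      also have "\<dots> = C (N (- t) (N t (N' t x)))" by (simp add: NC[symmetric] NC[of "- t", simplified])
      also have "\<dots> = C (N (- t) x)" by (simp add: NN')
      finally show ?thesis by (metis N'N)
    qed
    show "adjoint_pair (g t) (g t)" unfolding adjoint_pair_def
    proof (intro allI)
      fix x y
      have "g t x \<bullet> y = x \<bullet> N' (- t) (C (N (- t) y))"
        by (simp add: g_def adjoint_pairD[OF N_adj] adjoint_pairD[OF C_adj] adjoint_pairD[OF N'_adj])
      then show "g t x \<bullet> y = x \<bullet> g t y" by (simp add: sym)
    qed
    show "g t (g t x) = x" for x by (simp add: g_def NN' N'N CC)
    show "g t (j x) = - j (g t x)" for x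
      by (simp add: g_def N'j Cj N Kj blinfun.bilinear_simps)
    show "local_op (g t)" unfolding g_def
      by (intro local_op_compose N_local N'_local conj_opsD(4)[OF C])
  qed
  moreover have "g 0 = C"
  proof (rule blinfun_eqI)
    fix x
    have N0: "N 0 y = y" for y by (simp add: N)
    have "N' 0 x = x" using N'N[of 0 x] by (simp add: N0)
    then show "g 0 x = C x" by (simp add: g_def N0)
  qed
  \<comment> \<open>At \<open>t = 1\<close> the operator \<open>1 + K\<close> equals
    \<open>2 T G\<close>, and it intertwines \<open>C\<close> with \<open>T\<close>.\<close>
  moreover have "g 1 = T"
  proof (rule blinfun_eqI)
    fix x
    have N1: "N 1 y = 2 *\<^sub>R T (G y)" for y using TG'[of y] by (simp add: N K scaleR_2)
    have "N 1 (C y) = T (N 1 y)" for y by (simp add: N1 GC TT blinfun.bilinear_simps)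
    then have "g 1 x = T (N 1 (N' 1 x))" by (simp add: g_def)
    then show "g 1 x = T x" by (simp add: NN')
  qed
  ultimately show ?thesis
    unfolding path_component_def path_def path_image_def pathstart_def pathfinish_def by blast
qed

lemma path_component_conj_ops:
  fixes T C :: "'a \<Rightarrow>\<^sub>L 'a"
  assumes T: "T \<in> conj_ops" and C: "C \<in> conj_ops" and "\<And>x. C (\<Lambda> x) = \<Lambda> (C x)"
  shows "path_component conj_ops T C"
proof -
  obtain T1 B :: "'a \<Rightarrow>\<^sub>L 'a" where 1: "T1 \<in> conj_ops" "path_component conj_ops T T1"
    "adjoint_pair B B" "\<And>x. norm x \<le> norm (B x)" "compact_op (T1 + C - B)"
    using path_to_positive_anticommutator[OF assms] by blast
  obtain T2 :: "'a \<Rightarrow>\<^sub>L 'a" and c where 2: "T2 \<in> conj_ops" "path_component conj_ops T1 T2"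
    "c > 0" "\<And>x. c * norm x \<le> norm ((T2 + C) x)"
    using path_to_bounded_below[OF 1(1) C 1(3,4,5)] by blast
  have "path_component conj_ops T2 C"
    using Cayley_path[OF 2(1) C 2(3,4)] by (rule path_component_sym)
  then show ?thesis using 1(2) 2(2) path_component_trans by blast
qed

end

subsection \<open>Complex structure\<close>

lemma inner_scaleC_ii_right: "x \<bullet> (\<i> *\<^sub>C y) = - Im (cinner x y)"
  by (simp add: inner_eq_Re_cinner cinner_scaleC_right)

lemma inner_scaleC_ii_left: "(\<i> *\<^sub>C x) \<bullet> y = Im (cinner x y)"
  by (subst inner_commute) (simp add: inner_scaleC_ii_right cinner_commute[of x y])

lemma scaleC_ii_ii: "\<i> *\<^sub>C \<i> *\<^sub>C x = - x"
proof -
  have "\<i> *\<^sub>C \<i> *\<^sub>C x = (-1) *\<^sub>R x" by (simp add: scaleC_scaleC scaleR_eq_scaleC)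
  then show ?thesis by simp
qed

lemma scaleC_eq_Re_Im: "c *\<^sub>C x = Re c *\<^sub>R x + Im c *\<^sub>R (\<i> *\<^sub>C x)"
  unfolding scaleR_eq_scaleC scaleC_scaleC scaleC_add_left[symmetric]
  by (simp add: complex_eq[symmetric] mult.commute)

definition scale_ii :: "'a::complex_hilbert_space \<Rightarrow>\<^sub>L 'a" where
  "scale_ii = Blinfun (\<lambda>x. \<i> *\<^sub>C x)"

lemma scale_ii_apply [simp]: "scale_ii x = \<i> *\<^sub>C x"
proof -
  have "bounded_linear (\<lambda>x::'a. \<i> *\<^sub>C x)"
  proof (rule bounded_linear_intro[where K=1])
    fix x :: 'a
    have "(\<i> *\<^sub>C x) \<bullet> (\<i> *\<^sub>C x) = x \<bullet> x"
      unfolding inner_scaleC_ii_left by (simp add: cinner_scaleC_right inner_eq_Re_cinner)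
    then show "norm (\<i> *\<^sub>C x) \<le> norm x * 1" by (simp add: norm_eq_sqrt_inner)
  qed (simp_all add: scaleC_add_right scaleR_eq_scaleC scaleC_scaleC mult.commute)
  then show ?thesis by (simp add: scale_ii_def bounded_linear_Blinfun_apply)
qed

lemma adjoint_pair_scale_ii: "adjoint_pair scale_ii (- scale_ii)"
  by (simp add: adjoint_pair_def blinfun.bilinear_simps inner_scaleC_ii_left inner_scaleC_ii_right)

text \<open>Real linearity is built into the type, so commuting with the imaginary unit is all that
  remains.\<close>

lemma bounded_ops_iff: "A \<in> bounded_ops \<longleftrightarrow> (\<forall>x. A (\<i> *\<^sub>C x) = \<i> *\<^sub>C A x)"
proof
  assume "\<forall>x. A (\<i> *\<^sub>C x) = \<i> *\<^sub>C A x"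
  then have "A (c *\<^sub>C x) = c *\<^sub>C A x" for c x
    unfolding scaleC_eq_Re_Im[of c] by (simp add: blinfun.bilinear_simps)
  then show "A \<in> bounded_ops" by (simp add: bounded_ops_def)
qed (simp add: bounded_ops_def)

text \<open>The real part of the defining identity of \<open>cadjoint\<close> is the real adjoint
  relation; its imaginary part is the same relation at \<open>\<i> *\<^sub>C x\<close>.\<close>

lemma cadjoint_eq:
  fixes A B :: "'a::complex_hilbert_space \<Rightarrow>\<^sub>L 'a"
  assumes A: "A \<in> bounded_ops" and B: "adjoint_pair A B"
  shows "cadjoint A = B"
  unfolding cadjoint_def
proof (rule the_equality)
  have "Re (cinner (A x) y) = Re (cinner x (B y))" for x y
    using adjoint_pairD[OF B, of x y] by (simp add: inner_eq_Re_cinner)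
  moreover have "Im (cinner (A x) y) = Im (cinner x (B y))" for x y
    using adjoint_pairD[OF B, of "\<i> *\<^sub>C x" y] A by (simp add: bounded_ops_iff inner_scaleC_ii_left)
  ultimately show "\<forall>x y. cinner (A x) y = cinner x (B y)" by (simp add: complex_eq_iff)
next
  fix B' assume B': "\<forall>x y. cinner (blinfun_apply A x) y = cinner x (blinfun_apply B' y)"
  have "x \<bullet> B' y = x \<bullet> B y" for x y
    using B' unfolding adjoint_pairD[OF B, symmetric] by (simp add: inner_eq_Re_cinner)
  then show "B' = B" by (intro blinfun_eqI) (metis vector_eq_ldot)
qed

lemma adjoint_pair_cadjoint: "A \<in> bounded_ops \<Longrightarrow> adjoint_pair A (cadjoint A)"
  using adjoint_pair_exists[of A] cadjoint_eq by metis

section \<open>Star-real local unitaries as local conjugations\<close>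

theorem theorem3p2:
  fixes \<Lambda> :: "'a::complex_hilbert_space \<Rightarrow>\<^sub>L 'a"
    and C :: "'a \<Rightarrow> 'a"
  assumes "separable_space (euclidean :: 'a topology)"
    and "infinite_cdim (UNIV :: 'a set)"
    and "selfadjoint_projection \<Lambda>"
    and "infinite_cdim (range (blinfun_apply \<Lambda>))"
    and "infinite_cdim {x. blinfun_apply \<Lambda> x = 0}"
    and "antiunitary C"
    and "C \<circ> C = id"
    and "C \<circ> blinfun_apply \<Lambda> = blinfun_apply \<Lambda> \<circ> C"
  shows "card (path_components_of (top_of_set (star_real_local_unitaries \<Lambda> C))) = 1"
proof -
  have \<Lambda>: "\<Lambda> \<in> bounded_ops" "adjoint_pair \<Lambda> \<Lambda>" "\<And>x. \<Lambda> (\<Lambda> x) = \<Lambda> x"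
    using assms(3) adjoint_pair_cadjoint[of \<Lambda>] unfolding selfadjoint_projection_def
    by (auto dest: arg_cong[where f="\<lambda>f. blinfun_apply f x" for x] simp flip: blinfun_apply_blinfun_compose)
  have CC: "C (C x) = x" for x using assms(7) by (metis comp_apply id_apply)
  have C_i: "C (\<i> *\<^sub>C x) = - (\<i> *\<^sub>C C x)" for x
    using assms(6) by (simp add: antiunitary_def)
  have C_inner: "C x \<bullet> C y = x \<bullet> y" for x y
    using assms(6) by (simp add: antiunitary_def inner_eq_Re_cinner)
  have "bounded_linear C"
  proof (rule bounded_linear_intro[where K=1])
    show "C (x + y) = C x + C y" for x y using assms(6) by (simp add: antiunitary_def)
    show "C (r *\<^sub>R x) = r *\<^sub>R C x" for r x using assms(6) by (simp add: antiunitary_def scaleR_eq_scaleC)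
    show "norm (C x) \<le> norm x * 1" for x by (simp add: norm_eq_sqrt_inner C_inner)
  qed
  then have ap: "blinfun_apply (Blinfun C) = C" by (rule bounded_linear_Blinfun_apply)
  interpret graded_structure scale_ii \<Lambda>
    by unfold_locales (use \<Lambda> in \<open>simp_all add: adjoint_pair_scale_ii scaleC_ii_ii bounded_ops_iff\<close>)
  have C_adj: "adjoint_pair (Blinfun C) (Blinfun C)"
    unfolding adjoint_pair_def ap by (metis C_inner CC)
  have C\<Lambda>: "C (\<Lambda> x) = \<Lambda> (C x)" for x using assms(8) by (metis comp_apply)
  have C_conj: "Blinfun C \<in> conj_ops"
    by (intro conj_opsI C_adj local_op_commute) (simp_all add: ap CC C_i C\<Lambda>)
  \<comment> \<open>Both are joined to \<open>C\<close>, the one conjugation known to commute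
    exactly with \<Lambda>.\<close>
  have "path_component conj_ops T T'" if "T \<in> conj_ops" "T' \<in> conj_ops" for T T'
    using path_component_conj_ops[OF _ C_conj] that C\<Lambda> path_component_sym path_component_trans
    unfolding ap by metis
  then have "path_connected conj_ops" by (simp add: path_connected_component)
  then have pc: "path_connected ((\<lambda>T. Blinfun C o\<^sub>L T) ` conj_ops)"
    by (intro path_connected_continuous_image continuous_intros)
  \<comment> \<open>Left multiplication by \<open>C\<close> is its own inverse. Under it,
    \<open>U C = C U*\<close> becomes symmetry of \<open>C U\<close>, and unitarity of
    \<open>U\<close> becomes that \<open>C U\<close> is an involution.\<close>
  have eq: "(\<lambda>T. Blinfun C o\<^sub>L T) ` conj_ops = star_real_local_unitaries \<Lambda> C"
  proof (intro equalityI subsetI)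
    fix U assume "U \<in> (\<lambda>T. Blinfun C o\<^sub>L T) ` conj_ops"
    then obtain T where T: "T \<in> conj_ops" and U_def: "U = Blinfun C o\<^sub>L T" by blast
    have U: "U x = C (T x)" for x by (simp add: U_def ap)
    have Tj: "T (\<i> *\<^sub>C x) = - (\<i> *\<^sub>C T x)" for x using conj_opsD(3)[OF T, of x] by simp
    have U_adj: "adjoint_pair U (T o\<^sub>L Blinfun C)"
      unfolding U_def by (intro adjoint_pair_compose C_adj conj_opsD(1)[OF T])
    have Ub: "U \<in> bounded_ops"
      unfolding bounded_ops_iff U Tj using C_i blinfun.minus_right[of "Blinfun C"] by (simp add: ap)
    have cU: "cadjoint U = T o\<^sub>L Blinfun C" by (rule cadjoint_eq[OF Ub U_adj])
    have "U \<in> unitary_ops"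
      unfolding unitary_ops_def using Ub
      by (auto intro!: blinfun_eqI simp: cU U ap CC conj_opsD(2)[OF T])
    moreover have "local_op U"
      unfolding U_def by (intro local_op_compose conj_opsD(4)[OF C_conj] conj_opsD(4)[OF T])
    then have "U \<in> local_ops \<Lambda>"
      unfolding local_ops_def compact_ops_def local_op_def compact_op_def
      using Ub \<Lambda>(1) by (simp add: bounded_ops_iff blinfun.bilinear_simps complex_vector.scale_right_diff_distrib)
    moreover have "blinfun_apply U \<circ> C = C \<circ> blinfun_apply (cadjoint U)"
      by (simp add: fun_eq_iff cU U ap)
    ultimately show "U \<in> star_real_local_unitaries \<Lambda> C" by (simp add: star_real_local_unitaries_def)
  next
    fix U assume U: "U \<in> star_real_local_unitaries \<Lambda> C"
    have Ub: "U \<in> bounded_ops" and Ul: "local_op U"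
      using U unfolding star_real_local_unitaries_def local_ops_def compact_ops_def local_op_def compact_op_def
      by auto
    have UU: "cadjoint U (U x) = x" for x
      using U unfolding star_real_local_unitaries_def unitary_ops_def
      by (metis (mono_tags, lifting) IntD1 blinfun_apply_blinfun_compose blinfun_apply_id_blinfun id_apply mem_Collect_eq)
    have UC: "U (C x) = C (cadjoint U x)" for x
      using U unfolding star_real_local_unitaries_def by (simp add: fun_eq_iff)
    have CU: "cadjoint U (C x) = C (U x)" for x using UC[of "C x"] by (metis CC)
    have "Blinfun C o\<^sub>L U \<in> conj_ops"
    proof (rule conj_opsI)
      have "cadjoint U o\<^sub>L Blinfun C = Blinfun C o\<^sub>L U" by (intro blinfun_eqI) (simp add: ap CU)
      then show "adjoint_pair (Blinfun C o\<^sub>L U) (Blinfun C o\<^sub>L U)"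
        using adjoint_pair_compose[OF C_adj adjoint_pair_cadjoint[OF Ub]] by simp
      show "local_op (Blinfun C o\<^sub>L U)" by (intro local_op_compose conj_opsD(4)[OF C_conj] Ul)
    qed (use Ub in \<open>simp_all add: ap UC CC UU C_i bounded_ops_iff\<close>)
    moreover have "U = Blinfun C o\<^sub>L (Blinfun C o\<^sub>L U)" by (intro blinfun_eqI) (simp add: ap CC)
    ultimately show "U \<in> (\<lambda>T. Blinfun C o\<^sub>L T) ` conj_ops" by blast
  qed
  with pc have "path_connected_space (top_of_set (star_real_local_unitaries \<Lambda> C))"
    unfolding path_connected_space_def path_connected_def path_defs pathin_def
    by (simp add: image_subset_iff_funcset)
  \<comment> \<open>The empty space would have no component at all; here the image of
    \<open>C\<close> itself is the identity operator.\<close>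
  moreover have "star_real_local_unitaries \<Lambda> C \<noteq> {}"
    using eq C_conj by blast
  ultimately show ?thesis by (simp add: path_components_of_path_connected_space)
qed

end
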